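(* Let $\pi\colon \mathrm{GL}(n)\to \mathrm{GL}(V)$ be a rational representation on a finite-dimensional complex vector space $V$ with a $U(n)$-invariant Hermitian inner product, and let $v\in V\setminus\{0\}$. Then $0\in\Delta(v)$ if and only if $\Delta(v)$ contains a point of Euclidean norm smaller than $\gamma(\pi)$. In particular, solving the scaling problem with input $(\pi,v,\gamma(\pi)/2)$, or solving the norm minimization problem with input $\bigl(\pi,v,\tfrac18(\gamma(\pi)/2N(\pi))^2\bigr)$, suffices to solve the null cone membership problem for $(\pi,v)$. That is: if $g\in\mathrm{GL}(n)$ is the output on $v$ of any procedure that is guaranteed to return a valid solution of the respective problem whenever $\operatorname{cap}(v)>0$ (and returns an arbitrary group element otherwise), then $\operatorname{cap}(v)>0$ if and only if $\|\mu(\pi(g)v)\|_F\le\gamma(\pi)/2$.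
   Context: Rational representation: a group homomorphism whose matrix entries are polynomials in the $g_{i,j}$ and $\det(g)^{-1}$; the inner product is such that $\pi(U(n))$ acts by unitary maps, and $\|\cdot\|$ is its norm. $\|\cdot\|_F$ is the Frobenius norm. Capacity: $\operatorname{cap}(v)=\inf_{g\in \mathrm{GL}(n)}\|\pi(g)v\|$. The null cone membership problem: given $(\pi,v)$, decide whether $\operatorname{cap}(v)=0$, equivalently $0\notin\Delta(v)$. Moment map: $\mu\colon V\setminus\{0\}\to \mathrm{Herm}(n)$ is defined by $\operatorname{tr}[\mu(v)H]=\partial_{t=0}\log\|\pi(e^{tH})v\|$ for all Hermitian $H$. Moment polytope: $\Delta(v)\subset\mathbb R^n$ is the closure of $\{\operatorname{spec}(\mu(w)):w\in\pi(\mathrm{GL}(n))v\}$, where $\operatorname{spec}$ lists eigenvalues in nonincreasing order. Scaling problem: given $(\pi,v,\varepsilon)$ with $0\in\Delta(v)$, output $g\in \mathrm{GL}(n)$ with $\|\mu(\pi(g)v)\|_F\le\varepsilon$. Norm minimization problem: given $(\pi,v,\varepsilon)$ with $\operatorname{cap}(v)>0$, output $g$ with $\log\|\pi(g)v\|-\log\operatorname{cap}(v)\le\varepsilon$. Weights: $\Omega(\pi)\subset\mathbb Z^n$ is the set of $\omega$ such that there is a nonzero $w\in V$ with $\pi(\operatorname{diag}(x))w=\prod_i x_i^{\omega_i}w$ for all invertible diagonal matrices. Weight norm: $N(\pi)$ is the maximum of $\|\lambda\|_2$ over the highest weights $\lambda$ of irreducible subrepresentations of $\pi$. Weight margin: $\gamma(\pi)$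 is the minimum Euclidean distance from the origin to $\operatorname{conv}(\Gamma)$ over nonempty $\Gamma\subseteq\Omega(\pi)$ with $0\notin\operatorname{conv}(\Gamma)$. (The representation is understood to have a nonzero weight, so that $\gamma(\pi)$ and $N(\pi)$ are finite and positive.) *)

theory Defs
  imports "HOL-Analysis.Analysis"
begin

section \<open>Complex matrices\<close>

text \<open>
  The index type \<open>'n\<close> stands for \<open>{1..n}\<close>. Its linear order is used only for
  listing eigenvalues in nonincreasing order and for upper triangularity.
\<close>

definition conj_transpose :: "complex^'n^'m \<Rightarrow> complex^'m^'n" where
  "conj_transpose A = (\<chi> i j. cnj (A $ j $ i))"

definition hermitian_matrix :: "complex^'n^'n \<Rightarrow> bool" where
  "hermitian_matrix A \<longleftrightarrow> conj_transpose A = A"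

definition unitary_matrix :: "complex^'n^'n \<Rightarrow> bool" where
  "unitary_matrix A \<longleftrightarrow> conj_transpose A ** A = mat 1 \<and> A ** conj_transpose A = mat 1"

definition diag_matrix :: "complex^'n \<Rightarrow> complex^'n^'n" where
  "diag_matrix x = (\<chi> i j. if i = j then x $ i else 0)"

definition upper_unitriangular :: "complex^'n::{finite,linorder}^'n::{finite,linorder} \<Rightarrow> bool" where
  "upper_unitriangular A \<longleftrightarrow> (\<forall>i. A $ i $ i = 1) \<and> (\<forall>i j. j < i \<longrightarrow> A $ i $ j = 0)"

text \<open>
  \<open>times\<close> and \<open>power\<close> on the vector type are componentwise, so the matrix
  exponential is written with iterated matrix multiplication.
\<close>

definition matrix_exp :: "complex^'n^'n \<Rightarrow> complex^'n^'n" where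
  "matrix_exp A = (\<Sum>k. (1 / fact k) *\<^sub>R (((**) A) ^^ k) (mat 1))"

text \<open>
  Eigenvalues of a Hermitian matrix with multiplicity, in nonincreasing order:
  the components are the roots of the characteristic polynomial.
\<close>

definition spec ::
    "complex^'n::{finite,linorder}^'n::{finite,linorder} \<Rightarrow> real^'n::{finite,linorder}" where
  "spec A = (THE x. (\<forall>i j. i \<le> j \<longrightarrow> x $ j \<le> x $ i) \<and>
     (\<forall>z. det (mat z - A) = (\<Prod>i\<in>UNIV. z - complex_of_real (x $ i))))"

text \<open>The library norm on matrices is the Frobenius norm.\<close>

lemma norm_matrix_eq_frobenius:
  fixes A :: "complex^'n^'m"
  shows "norm A = sqrt (\<Sum>i\<in>UNIV. \<Sum>j\<in>UNIV. (cmod (A $ i $ j))\<^sup>2)"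
  by (simp add: norm_vec_def L2_set_def sum_nonneg)

section \<open>Rational representations with an invariant inner product\<close>

text \<open>
  Polynomials in the entries and the inverse determinant, as functions; only
  their values on invertible matrices matter.
\<close>

inductive regular_function :: "(complex^'n^'n \<Rightarrow> complex) \<Rightarrow> bool" where
  const: "regular_function (\<lambda>g. c)"
| entry: "regular_function (\<lambda>g. g $ i $ j)"
| inverse_det: "regular_function (\<lambda>g. inverse (det g))"
| add: "regular_function p \<Longrightarrow> regular_function q \<Longrightarrow> regular_function (\<lambda>g. p g + q g)"
| mult: "regular_function p \<Longrightarrow> regular_function q \<Longrightarrow> regular_function (\<lambda>g. p g * q g)"

text \<open>
  \<open>V\<close> is the whole type \<open>'v\<close>, with complex scalar multiplication \<open>scaleC\<close> and a finite
  basis \<open>Basis\<close>. \<open>GL(n)\<close> is the set of invertible matrices; the values of \<open>\<pi>\<close> at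
  singular matrices are irrelevant. Invertibility of \<open>\<pi> g\<close> follows from the
  homomorphism laws.
\<close>

locale rational_representation =
  finite_dimensional_vector_space scaleC Basis
  for scaleC :: "complex \<Rightarrow> 'v::ab_group_add \<Rightarrow> 'v" and Basis :: "'v set" +
  fixes \<pi> :: "complex^'n^'n \<Rightarrow> 'v \<Rightarrow> 'v"
  assumes linear_rep: "invertible g \<Longrightarrow> Vector_Spaces.linear scaleC scaleC (\<pi> g)"
    and rep_one: "\<pi> (mat 1) w = w"
    and rep_mult: "invertible g \<Longrightarrow> invertible h \<Longrightarrow> \<pi> (g ** h) w = \<pi> g (\<pi> h w)"
    and rational_entries: "b \<in> Basis \<Longrightarrow> c \<in> Basis \<Longrightarrow>
      \<exists>p. regular_function p \<and> (\<forall>g. invertible g \<longrightarrow> representation Basis (\<pi> g b) c = p g)"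

locale hermitian_inner_product = vector_space scaleC
  for scaleC :: "complex \<Rightarrow> 'v::ab_group_add \<Rightarrow> 'v" +
  fixes ip :: "'v \<Rightarrow> 'v \<Rightarrow> complex"
  assumes ip_add_right: "ip x (y + z) = ip x y + ip x z"
    and ip_scale_right: "ip x (scaleC c y) = c * ip x y"
    and ip_commute: "ip y x = cnj (ip x y)"
    and ip_pos: "x \<noteq> 0 \<Longrightarrow> Re (ip x x) > 0"

definition unitary_invariant ::
    "('v \<Rightarrow> 'v \<Rightarrow> complex) \<Rightarrow> (complex^'n^'n \<Rightarrow> 'v \<Rightarrow> 'v) \<Rightarrow> bool" where
  "unitary_invariant ip \<pi> \<longleftrightarrow>
     (\<forall>u x y. unitary_matrix u \<longrightarrow> ip (\<pi> u x) (\<pi> u y) = ip x y)"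

definition ip_norm :: "('v \<Rightarrow> 'v \<Rightarrow> complex) \<Rightarrow> 'v \<Rightarrow> real" where
  "ip_norm ip x = sqrt (Re (ip x x))"

section \<open>Capacity, moment map and moment polytope\<close>

definition capacity ::
    "('v \<Rightarrow> 'v \<Rightarrow> complex) \<Rightarrow> (complex^'n^'n \<Rightarrow> 'v \<Rightarrow> 'v) \<Rightarrow> 'v \<Rightarrow> real" where
  "capacity ip \<pi> v = (INF g\<in>{g. invertible g}. ip_norm ip (\<pi> g v))"

definition moment_map ::
    "('v \<Rightarrow> 'v \<Rightarrow> complex) \<Rightarrow> (complex^'n^'n \<Rightarrow> 'v \<Rightarrow> 'v) \<Rightarrow> 'v \<Rightarrow> complex^'n^'n" where
  "moment_map ip \<pi> v = (THE M. hermitian_matrix M \<and>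
     (\<forall>H. hermitian_matrix H \<longrightarrow>
        (\<exists>d. ((\<lambda>t. ln (ip_norm ip (\<pi> (matrix_exp (t *\<^sub>R H)) v))) has_real_derivative d) (at 0) \<and>
             trace (M ** H) = complex_of_real d)))"

definition moment_polytope ::
    "('v \<Rightarrow> 'v \<Rightarrow> complex) \<Rightarrow>
     (complex^'n::{finite,linorder}^'n::{finite,linorder} \<Rightarrow> 'v \<Rightarrow> 'v) \<Rightarrow> 'v
      \<Rightarrow> (real^'n::{finite,linorder}) set" where
  "moment_polytope ip \<pi> v =
     closure {spec (moment_map ip \<pi> (\<pi> g v)) | g. invertible g}"

section \<open>Weights, weight norm and weight margin\<close>

definition weight_vector ::
    "(complex \<Rightarrow> 'v \<Rightarrow> 'v) \<Rightarrow> (complex^'n^'n \<Rightarrow> 'v \<Rightarrow> 'v) \<Rightarrow> int^'n \<Rightarrow> 'v::ab_group_add \<Rightarrow> bool"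
  where
  "weight_vector scaleC \<pi> \<omega> w \<longleftrightarrow> w \<noteq> 0 \<and>
     (\<forall>x. (\<forall>i. x $ i \<noteq> 0) \<longrightarrow>
        \<pi> (diag_matrix x) w = scaleC (\<Prod>i\<in>UNIV. (x $ i) powi (\<omega> $ i)) w)"

definition weights ::
    "(complex \<Rightarrow> 'v \<Rightarrow> 'v) \<Rightarrow> (complex^'n^'n \<Rightarrow> 'v \<Rightarrow> 'v::ab_group_add) \<Rightarrow> (int^'n) set" where
  "weights scaleC \<pi> = {\<omega>. \<exists>w. weight_vector scaleC \<pi> \<omega> w}"

definition real_weight :: "int^'n \<Rightarrow> real^'n" where
  "real_weight \<omega> = (\<chi> i. real_of_int (\<omega> $ i))"

definition subrepresentation ::
    "(complex \<Rightarrow> 'v \<Rightarrow> 'v) \<Rightarrow> (complex^'n^'n \<Rightarrow> 'v \<Rightarrow> 'v::ab_group_add) \<Rightarrow> 'v set \<Rightarrow> bool" where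
  "subrepresentation scaleC \<pi> W \<longleftrightarrow>
     module.subspace scaleC W \<and> (\<forall>g. invertible g \<longrightarrow> \<pi> g ` W \<subseteq> W)"

definition irreducible_subrepresentation ::
    "(complex \<Rightarrow> 'v \<Rightarrow> 'v) \<Rightarrow> (complex^'n^'n \<Rightarrow> 'v \<Rightarrow> 'v::ab_group_add) \<Rightarrow> 'v set \<Rightarrow> bool" where
  "irreducible_subrepresentation scaleC \<pi> W \<longleftrightarrow>
     subrepresentation scaleC \<pi> W \<and> W \<noteq> {0} \<and>
     (\<forall>U. subrepresentation scaleC \<pi> U \<and> U \<subseteq> W \<longrightarrow> U = {0} \<or> U = W)"

text \<open>
  A highest weight is the weight of a vector fixed by all upper unitriangular matrices.
\<close>

definition highest_weight ::
    "(complex \<Rightarrow> 'v \<Rightarrow> 'v) \<Rightarrow>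
     (complex^'n::{finite,linorder}^'n::{finite,linorder} \<Rightarrow> 'v \<Rightarrow> 'v::ab_group_add)
      \<Rightarrow> 'v set \<Rightarrow> int^'n::{finite,linorder} \<Rightarrow> bool" where
  "highest_weight scaleC \<pi> W \<omega> \<longleftrightarrow>
     (\<exists>w\<in>W. weight_vector scaleC \<pi> \<omega> w \<and> (\<forall>u. upper_unitriangular u \<longrightarrow> \<pi> u w = w))"

definition weight_norm ::
    "(complex \<Rightarrow> 'v \<Rightarrow> 'v) \<Rightarrow>
     (complex^'n::{finite,linorder}^'n::{finite,linorder} \<Rightarrow> 'v \<Rightarrow> 'v::ab_group_add)
      \<Rightarrow> real" where
  "weight_norm scaleC \<pi> = Max {norm (real_weight \<omega>) | \<omega>.
     \<exists>W. irreducible_subrepresentation scaleC \<pi> W \<and> highest_weight scaleC \<pi> W \<omega>}"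

definition weight_margin ::
    "(complex \<Rightarrow> 'v \<Rightarrow> 'v) \<Rightarrow> (complex^'n^'n \<Rightarrow> 'v \<Rightarrow> 'v::ab_group_add) \<Rightarrow> real" where
  "weight_margin scaleC \<pi> = Min {infdist 0 (convex hull (real_weight ` \<Gamma>)) | \<Gamma>.
     \<Gamma> \<noteq> {} \<and> \<Gamma> \<subseteq> weights scaleC \<pi> \<and> 0 \<notin> convex hull (real_weight ` \<Gamma>)}"

section \<open>Computational problems\<close>

text \<open>
  The output conditions only. The promise on the input (\<open>0 \<in> \<Delta>(v)\<close>, respectively
  \<open>cap(v) > 0\<close>) has to be stated separately.
\<close>

definition scaling_solution ::
    "('v \<Rightarrow> 'v \<Rightarrow> complex) \<Rightarrow> (complex^'n^'n \<Rightarrow> 'v \<Rightarrow> 'v) \<Rightarrow> 'v \<Rightarrow> real \<Rightarrow> complex^'n^'n \<Rightarrow> bool"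
  where
  "scaling_solution ip \<pi> v \<epsilon> g \<longleftrightarrow>
     invertible g \<and> norm (moment_map ip \<pi> (\<pi> g v)) \<le> \<epsilon>"

definition norm_minimization_solution ::
    "('v \<Rightarrow> 'v \<Rightarrow> complex) \<Rightarrow> (complex^'n^'n \<Rightarrow> 'v \<Rightarrow> 'v) \<Rightarrow> 'v \<Rightarrow> real \<Rightarrow> complex^'n^'n \<Rightarrow> bool"
  where
  "norm_minimization_solution ip \<pi> v \<epsilon> g \<longleftrightarrow>
     invertible g \<and> ln (ip_norm ip (\<pi> g v)) - ln (capacity ip \<pi> v) \<le> \<epsilon>"

end

theory Submission
  imports Defs
begin

text \<open>
  Write \<open>\<gamma>\<close> for the weight margin, \<open>N\<close> for the weight norm and \<open>\<mu>\<close> for the moment map. Two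
  inequalities at a point \<open>w \<noteq> 0\<close> of the orbit carry the theorem. Every invertible \<open>h\<close> satisfies
  \<open>\<parallel>\<pi>(h) w\<parallel>\<^sup>2 \<ge> \<parallel>w\<parallel>\<^sup>2 (1 - \<parallel>\<mu>(w)\<parallel> / \<gamma>)\<close>, which is \<open>orbit_norm_lower_bound\<close>, and some
  invertible \<open>h\<close> satisfies \<open>\<parallel>\<pi>(h) w\<parallel>\<^sup>2 \<le> \<parallel>w\<parallel>\<^sup>2 (1 - \<parallel>\<mu>(w)\<parallel>\<^sup>2 / (4 N\<^sup>2))\<close>, which is
  \<open>gradient_step_decreases_norm\<close>. By the first, a single orbit point with \<open>\<parallel>\<mu>\<parallel> < \<gamma>\<close> makes the
  capacity positive. By the second, \<open>\<parallel>\<mu>(w)\<parallel>\<^sup>2\<close> is at most \<open>8 N\<^sup>2\<close> times the gap between \<open>ln \<parallel>w\<parallel>\<close>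
  and the logarithm of a positive capacity. So \<open>\<mu>\<close> tends to \<open>0\<close> along a minimizing sequence,
  which puts \<open>0\<close> into the moment polytope, and a gap of \<open>(\<gamma> / 2N)\<^sup>2 / 8\<close> gives
  \<open>\<parallel>\<mu>(w)\<parallel> \<le> \<gamma> / 2\<close>. Since \<open>spec\<close> preserves the norm of a Hermitian matrix, statements about
  points of the polytope are statements about \<open>\<parallel>\<mu>\<parallel>\<close>.

  Both inequalities reduce to the diagonal torus. For the first, write \<open>h = K exp(D) L\<close> with \<open>K\<close>,
  \<open>L\<close> unitary and \<open>D\<close> real diagonal. For the second, diagonalize \<open>\<mu>(w)\<close>. The space \<open>V\<close> is the
  orthogonal sum of its weight spaces, so the squared norm along the torus is an exponential sum
  \<open>\<Sum>\<^sub>\<omega> q\<^sub>\<omega> exp (2 \<langle>D, \<omega>\<rangle>)\<close>, where \<open>q\<^sub>\<omega>\<close> is the squared norm of a weight component, and the diagonal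
  part of \<open>\<mu>\<close> is the mean of the weights under \<open>q\<close>. The lower bound for such sums comes from
  splitting off from \<open>q\<close> a part with mean zero until \<open>0\<close> is no longer in the convex hull of the
  support. The definition of \<open>\<gamma>\<close> controls what remains. The upper bound is a quadratic estimate of
  the exponential function and uses that all weights have norm at most \<open>N\<close>.

  That last fact is where representation theory enters, because \<open>N\<close> only refers to highest weights.
  Let \<open>\<omega>\<close> be a weight of maximal norm; permutation matrices allow its entries to be taken
  nonincreasing. A suitable one-parameter subgroup of the torus contracts the upper unitriangular
  matrices to the identity and shrinks no component relative to weight \<open>\<omega>\<close>, and this forces a weight
  vector of weight \<open>\<omega>\<close> to be fixed by them. As \<open>\<pi>(g)\<close> and
  \<open>\<pi>(g\<^sup>*)\<close> are adjoint to each other, orthogonal complements of subrepresentations are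
  subrepresentations, and projection yields such a vector in an irreducible subrepresentation.
\<close>

section \<open>Complex matrices\<close>

lemma conj_transpose_mult:
  "conj_transpose (A ** B) = conj_transpose B ** conj_transpose A"
  for A :: "complex^'n^'m" and B :: "complex^'k^'n"
  by (simp add: conj_transpose_def matrix_matrix_mult_def vec_eq_iff mult.commute)

lemma conj_transpose_involution [simp]: "conj_transpose (conj_transpose A) = A"
  by (simp add: conj_transpose_def vec_eq_iff)

lemma conj_transpose_one [simp]: "conj_transpose (mat 1) = (mat 1 :: complex^'n^'n)"
  by (simp add: conj_transpose_def vec_eq_iff mat_def)

lemma conj_transpose_diag [simp]:
  "conj_transpose (diag_matrix x) = diag_matrix (\<chi> i. cnj (x $ i))"
  by (simp add: conj_transpose_def vec_eq_iff diag_matrix_def)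

lemma mult_diag_entry: "(A ** diag_matrix x) $ i $ j = A $ i $ j * x $ j"
proof -
  have "(A ** diag_matrix x) $ i $ j = (\<Sum>k\<in>UNIV. if k = j then A $ i $ j * x $ j else 0)"
    unfolding matrix_matrix_mult_def diag_matrix_def vec_lambda_beta by (intro sum.cong) auto
  then show ?thesis by simp
qed

lemma diag_mult_entry: "(diag_matrix x ** A) $ i $ j = x $ i * A $ i $ j"
proof -
  have "(diag_matrix x ** A) $ i $ j = (\<Sum>k\<in>UNIV. if k = i then x $ i * A $ i $ j else 0)"
    unfolding matrix_matrix_mult_def diag_matrix_def vec_lambda_beta by (intro sum.cong) auto
  then show ?thesis by simp
qed

lemma mult_diag_mult_entry:
  "(A ** diag_matrix x ** B) $ i $ j = (\<Sum>l\<in>UNIV. A $ i $ l * x $ l * B $ l $ j)"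
  by (simp add: matrix_matrix_mult_def[of "A ** diag_matrix x"] mult_diag_entry)

lemma diag_matrix_mult: "diag_matrix x ** diag_matrix y = diag_matrix (x * y)"
proof -
  have "(diag_matrix x ** diag_matrix y) $ i $ j = (\<Sum>k\<in>UNIV. if k = i then x $ i * diag_matrix y $ i $ j else 0)"
    for i j
    unfolding matrix_matrix_mult_def diag_matrix_def vec_lambda_beta by (intro sum.cong) auto
  then show ?thesis by (simp add: diag_matrix_def vec_eq_iff)
qed

lemma diag_matrix_one [simp]: "diag_matrix 1 = mat 1"
  by (simp add: diag_matrix_def mat_def vec_eq_iff)

lemma invertible_leftI: "B ** A = mat 1 \<Longrightarrow> invertible A"
  for A B :: "complex^'n^'n"
  using invertible_left_inverse by blast

lemma invertible_diag_matrix: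
  assumes "\<forall>i. x $ i \<noteq> 0" shows "invertible (diag_matrix x)"
proof (rule invertible_leftI)
  have "(\<chi> i. inverse (x $ i)) * x = 1" using assms by (simp add: vec_eq_iff)
  then show "diag_matrix (\<chi> i. inverse (x $ i)) ** diag_matrix x = mat 1"
    by (simp add: diag_matrix_mult)
qed

lemma unitary_invertible: "unitary_matrix U \<Longrightarrow> invertible U"
  unfolding unitary_matrix_def using invertible_leftI by blast

lemma unitary_conj_transpose: "unitary_matrix U \<Longrightarrow> unitary_matrix (conj_transpose U)"
  by (simp add: unitary_matrix_def)

lemma unitaryI: "conj_transpose U ** U = mat 1 \<Longrightarrow> unitary_matrix U"
  unfolding unitary_matrix_def using matrix_left_right_inverse by blast

lemma invertible_conj_transpose:
  assumes "invertible (A :: complex^'n^'n)" shows "invertible (conj_transpose A)"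
proof -
  obtain B where "A ** B = mat 1" using assms invertible_right_inverse by blast
  then have "conj_transpose B ** conj_transpose A = mat 1"
    by (metis conj_transpose_mult conj_transpose_one)
  then show ?thesis by (rule invertible_leftI)
qed

section \<open>Diagonalization of Hermitian matrices\<close>

text \<open>
  A maximizer of the Rayleigh quotient on the unit sphere of \<open>W\<close> is an eigenvector: the first
  variation in the direction \<open>f x - l x\<close>, which stays inside \<open>W\<close>, has to vanish.
\<close>

lemma selfadjoint_eigenvector:
  fixes f :: "'a::euclidean_space \<Rightarrow> 'a"
  assumes f: "linear f" and sa: "\<And>x y. inner (f x) y = inner x (f y)"
    and W: "subspace W" "\<And>x. x \<in> W \<Longrightarrow> f x \<in> W" and nz: "x0 \<in> W" "x0 \<noteq> 0"
  obtains x l where "x \<in> W" "norm x = 1" "f x = l *\<^sub>R x"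
proof -
  let ?S = "W \<inter> sphere 0 1"
  have "compact ?S" using W(1) by (simp add: closed_Int_compact closed_subspace)
  moreover have "x0 /\<^sub>R norm x0 \<in> ?S"
    using nz W(1) by (auto simp: subspace_scale)
  moreover have "continuous_on ?S (\<lambda>x. inner x (f x))"
    using f by (intro continuous_intros linear_continuous_on)
      (auto simp: linear_conv_bounded_linear)
  ultimately obtain x where x: "x \<in> ?S" and max: "\<And>y. y \<in> ?S \<Longrightarrow> inner y (f y) \<le> inner x (f x)"
    using continuous_attains_sup[of ?S] by blast
  define l where "l = inner x (f x)"
  have xW: "x \<in> W" and nx: "norm x = 1" using x by auto
  have le: "inner z (f z) \<le> l * (norm z)\<^sup>2" if z: "z \<in> W" for z
  proof (cases "z = 0")
    case True then show ?thesis using f by (simp add: linear_0)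
  next
    case False
    have "z /\<^sub>R norm z \<in> ?S" using z False W(1) by (auto simp: subspace_scale)
    from max[OF this] have "inner z (f z) / (norm z)\<^sup>2 \<le> l"
      by (simp add: l_def linear_scale[OF f] power2_eq_square field_simps)
    then show ?thesis using False by (simp add: field_simps)
  qed
  define y where "y = f x - l *\<^sub>R x"
  have yW: "y \<in> W" unfolding y_def using W xW by (intro subspace_diff subspace_scale) auto
  define C where "C = l * (norm y)\<^sup>2 - inner y (f y)"
  have sym: "inner x (f y) = inner y (f x)"
    using sa[of x y] by (simp add: inner_commute)
  have ny: "(norm y)\<^sup>2 = inner y (f x) - l * inner y x"
    unfolding power2_norm_eq_inner by (subst (2) y_def) (simp add: inner_diff_right)
  have first_variation: "2 * t * (norm y)\<^sup>2 \<le> t\<^sup>2 * C" for t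
  proof -
    have "inner (x + t *\<^sub>R y) (f (x + t *\<^sub>R y))
        = l + 2 * t * inner y (f x) + t\<^sup>2 * inner y (f y)"
      by (simp add: linear_add[OF f] linear_scale[OF f] inner_add_left inner_add_right l_def
          power2_eq_square sym algebra_simps)
    moreover have "(norm (x + t *\<^sub>R y))\<^sup>2 = 1 + 2 * t * inner y x + t\<^sup>2 * (norm y)\<^sup>2"
      using nx unfolding power2_norm_eq_inner
      by (simp add: inner_add_left inner_add_right inner_commute[of x y] norm_eq_1
          power2_eq_square algebra_simps)
    moreover have "x + t *\<^sub>R y \<in> W" using W xW yW by (intro subspace_add subspace_scale)
    ultimately have "l + 2 * t * inner y (f x) + t\<^sup>2 * inner y (f y)
        \<le> l * (1 + 2 * t * inner y x + t\<^sup>2 * (norm y)\<^sup>2)"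
      using le by metis
    then have "2 * t * (inner y (f x) - l * inner y x) \<le> t\<^sup>2 * C"
      by (simp add: C_def algebra_simps)
    then show ?thesis by (simp only: ny)
  qed
  have "y = 0"
  proof (rule ccontr)
    assume "y \<noteq> 0"
    then have p: "0 < (norm y)\<^sup>2" by simp
    \<comment> \<open>Small enough that the quadratic term cannot compensate the linear one.\<close>
    define t where "t = (norm y)\<^sup>2 / (1 + \<bar>C\<bar>)"
    have t: "0 < t" using p by (simp add: t_def add_pos_nonneg)
    have "t * (2 * (norm y)\<^sup>2) \<le> t * (t * C)"
      using first_variation[of t] by (simp add: power2_eq_square algebra_simps)
    then have "2 * (norm y)\<^sup>2 \<le> t * C" using t by simp
    also have "\<dots> \<le> t * (1 + \<bar>C\<bar>)" using t by (intro mult_left_mono) auto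
    also have "\<dots> = (norm y)\<^sup>2" by (simp add: t_def)
    finally show False using p by simp
  qed
  then show ?thesis using that[OF xW nx, of l] by (simp add: y_def)
qed

text \<open>
  The standard Hermitian form. The library inner product on complex vectors is its real part.
\<close>

definition cinner :: "complex^'n \<Rightarrow> complex^'n \<Rightarrow> complex" where
  "cinner x y = (\<Sum>i\<in>UNIV. cnj (x $ i) * y $ i)"

lemma Re_cinner: "Re (cinner x y) = inner x y"
  by (simp add: cinner_def inner_vec_def inner_complex_def)

lemma cinner_self: "cinner x x = complex_of_real ((norm x)\<^sup>2)"
proof -
  have "(norm x)\<^sup>2 = (\<Sum>i\<in>UNIV. (cmod (x $ i))\<^sup>2)"
    by (simp add: norm_vec_def L2_set_def sum_nonneg)
  then show ?thesis
    by (simp add: cinner_def complex_norm_square[symmetric] mult.commute[of "cnj _"])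
qed

lemma cinner_commute: "cinner y x = cnj (cinner x y)"
  by (simp add: cinner_def mult.commute)

lemma cinner_scaleR: "cinner (r *\<^sub>R x) y = of_real r * cinner x y"
  "cinner x (r *\<^sub>R y) = of_real r * cinner x y"
  by (simp_all add: cinner_def sum_distrib_left scaleR_conv_of_real[where 'a=complex] algebra_simps)

lemma cinner_add: "cinner x (y + z) = cinner x y + cinner x z"
  by (simp add: cinner_def sum.distrib algebra_simps)

lemma cinner_adjoint: "cinner (A *v x) y = cinner x (conj_transpose A *v y)"
proof -
  have "cinner (A *v x) y = (\<Sum>i\<in>UNIV. \<Sum>j\<in>UNIV. cnj (A $ i $ j) * cnj (x $ j) * y $ i)"
    by (simp add: cinner_def matrix_vector_mult_def sum_distrib_right)
  also have "\<dots> = (\<Sum>j\<in>UNIV. \<Sum>i\<in>UNIV. cnj (A $ i $ j) * cnj (x $ j) * y $ i)"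
    by (rule sum.swap)
  also have "\<dots> = cinner x (conj_transpose A *v y)"
    by (simp add: cinner_def matrix_vector_mult_def conj_transpose_def sum_distrib_left mult_ac)
  finally show ?thesis .
qed

lemma conj_transpose_mult_columns:
  fixes u :: "'n::finite \<Rightarrow> complex^'n"
  shows "conj_transpose (\<chi> i j. u j $ i) ** (\<chi> i j. u j $ i) = (\<chi> i j. cinner (u i) (u j))"
  by (simp add: conj_transpose_def matrix_matrix_mult_def vec_eq_iff cinner_def)

definition real_diag :: "real^'n \<Rightarrow> complex^'n^'n" where
  "real_diag h = diag_matrix (\<chi> i. complex_of_real (h $ i))"

definition exp_diag :: "real^'n \<Rightarrow> complex^'n^'n" where
  "exp_diag h = diag_matrix (\<chi> i. complex_of_real (exp (h $ i)))"

lemma conj_transpose_real_diag [simp]: "conj_transpose (real_diag h) = real_diag h"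
  by (simp add: real_diag_def)

lemma conj_transpose_exp_diag [simp]: "conj_transpose (exp_diag h) = exp_diag h"
  by (simp add: exp_diag_def)

lemma invertible_exp_diag: "invertible (exp_diag h)"
  unfolding exp_diag_def by (rule invertible_diag_matrix) simp

lemma exp_diag_mult: "exp_diag h ** exp_diag k = exp_diag (h + k)"
  by (simp add: exp_diag_def diag_matrix_mult)
     (simp add: diag_matrix_def vec_eq_iff exp_add)

lemma exp_diag_zero [simp]: "exp_diag 0 = mat 1"
  by (simp add: exp_diag_def diag_matrix_def mat_def vec_eq_iff)

text \<open>
  Eigenvectors are collected one index at a time. As long as some index is missing, a matrix with a
  zero row shows that the orthogonal complement of those found is nonzero, and
  \<open>selfadjoint_eigenvector\<close> applies to it because a Hermitian matrix preserves it.
\<close>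

lemma hermitian_diagonalization:
  fixes M :: "complex^'n^'n"
  assumes M: "hermitian_matrix M"
  obtains U h where "unitary_matrix U" "M = U ** real_diag h ** conj_transpose U"
proof -
  have sa: "cinner (M *v x) y = cinner x (M *v y)" for x y
    using M by (simp add: cinner_adjoint hermitian_matrix_def)
  have Mlin: "linear (\<lambda>x. M *v x)"
    by (rule linearI) (auto simp: matrix_vector_mult_def vec_eq_iff
        scaleR_sum_right sum.distrib algebra_simps)
  have "\<exists>u l. (\<forall>i\<in>S. \<forall>j\<in>S. cinner (u i) (u j) = (if i = j then 1 else 0)) \<and>
      (\<forall>i\<in>S. M *v u i = (l i :: real) *\<^sub>R u i)" for S :: "'n set"
    using finite[of S]
  proof (induction S rule: finite_induct)
    case empty then show ?case by simp
  next
    case (insert k S)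
    then obtain u l where u: "\<forall>i\<in>S. \<forall>j\<in>S. cinner (u i) (u j) = (if i = j then 1 else 0)"
      and l: "\<forall>i\<in>S. M *v u i = (l i :: real) *\<^sub>R u i" by blast
    define W where "W = {x. \<forall>i\<in>S. cinner (u i) x = 0}"
    define A :: "complex^'n^'n" where "A = (\<chi> i j. if i \<in> S then cnj (u i $ j) else 0)"
    have "row k A = 0" using insert.hyps by (simp add: row_def A_def vec_eq_iff)
    then have "det A = 0" by (rule det_zero_row)
    then have "\<not> invertible A" by (simp add: invertible_det_nz)
    then obtain x0 where x0: "A *v x0 = 0" "x0 \<noteq> 0"
      using matrix_left_invertible_ker[of A] invertible_left_inverse[of A] by blast
    have "x0 \<in> W" unfolding W_def
    proof safe
      fix i assume "i \<in> S"
      have "(A *v x0) $ i = 0" using x0 by simp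
      then show "cinner (u i) x0 = 0" using \<open>i \<in> S\<close>
        by (simp add: A_def matrix_vector_mult_def cinner_def)
    qed
    have W: "subspace W" by (auto simp: subspace_def W_def cinner_add cinner_scaleR)
       (simp add: cinner_def)
    have MW: "M *v x \<in> W" if "x \<in> W" for x
      using that l unfolding W_def by (auto simp: sa[symmetric] cinner_scaleR)
    have "inner (M *v x) y = inner x (M *v y)" for x y
      using sa by (metis Re_cinner)
    then obtain x c where x: "x \<in> W" "norm x = 1" "M *v x = c *\<^sub>R x"
      using selfadjoint_eigenvector[OF Mlin _ W MW \<open>x0 \<in> W\<close> \<open>x0 \<noteq> 0\<close>] by blast
    have xW: "cinner (u i) x = 0" "cinner x (u i) = 0" if "i \<in> S" for i
      using x(1) that by (auto simp: W_def cinner_commute[of x])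
    have "cinner x x = 1" using x(2) by (simp add: cinner_self)
    then show ?case
      using u l x xW insert.hyps
      by (intro exI[of _ "u(k := x)"] exI[of _ "l(k := c)"]) auto
  qed
  from this[of UNIV] obtain u l where
    u: "\<And>i j :: 'n. cinner (u i) (u j) = (if i = j then 1 else 0)"
    and l: "\<And>i :: 'n. M *v u i = (l i :: real) *\<^sub>R u i" by blast
  define U :: "complex^'n^'n" where "U = (\<chi> i j. u j $ i)"
  have U: "unitary_matrix U"
    by (rule unitaryI) (simp add: U_def conj_transpose_mult_columns u mat_def vec_eq_iff)
  have "M ** U = U ** real_diag (\<chi> i. l i)"
  proof -
    have "(M ** U) $ i $ j = (U ** real_diag (\<chi> i. l i)) $ i $ j" for i j
    proof -
      have "(M ** U) $ i $ j = (M *v u j) $ i"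
        by (simp add: U_def matrix_matrix_mult_def matrix_vector_mult_def)
      also have "\<dots> = (U ** real_diag (\<chi> i. l i)) $ i $ j"
        by (simp add: l U_def real_diag_def mult_diag_entry scaleR_conv_of_real[where 'a=complex])
      finally show ?thesis .
    qed
    then show ?thesis by (simp add: vec_eq_iff)
  qed
  then have "M = U ** real_diag (\<chi> i. l i) ** conj_transpose U"
    using U by (metis matrix_mul_assoc matrix_mul_rid unitary_matrix_def)
  with U show ?thesis by (rule that)
qed

text \<open>
  Diagonalize \<open>g\<^sup>* g = U exp(2h) U\<^sup>*\<close>. Then \<open>g U exp(-h)\<close> is unitary.
\<close>

lemma KAK_decomposition:
  fixes g :: "complex^'n^'n"
  assumes g: "invertible g"
  obtains K h L where "unitary_matrix K" "unitary_matrix L" "g = K ** exp_diag h ** L"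
proof -
  define P where "P = conj_transpose g ** g"
  have "hermitian_matrix P" by (simp add: P_def hermitian_matrix_def conj_transpose_mult)
  then obtain U d where U: "unitary_matrix U" and P: "P = U ** real_diag d ** conj_transpose U"
    by (rule hermitian_diagonalization)
  define B where "B = g ** U"
  have UU: "conj_transpose U ** U = mat 1" "U ** conj_transpose U = mat 1"
    using U by (auto simp: unitary_matrix_def)
  have BB: "conj_transpose B ** B = real_diag d"
  proof -
    have "conj_transpose B ** B = conj_transpose U ** P ** U"
      by (simp add: B_def P_def conj_transpose_mult matrix_mul_assoc)
    also have "\<dots> = (conj_transpose U ** U) ** real_diag d ** (conj_transpose U ** U)"
      by (simp add: P matrix_mul_assoc)
    finally show ?thesis by (simp add: UU)
  qed
  have Binv: "invertible B" unfolding B_def by (intro invertible_mult g unitary_invertible U)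
  have dpos: "0 < d $ i" for i
  proof -
    have B: "B = (\<chi> a b. column b B $ a)" by (simp add: column_def vec_eq_iff)
    have "real_diag d = (\<chi> i j. cinner (column i B) (column j B))"
      using BB conj_transpose_mult_columns[of "\<lambda>b. column b B", folded B] by simp
    then have "real_diag d $ i $ i = cinner (column i B) (column i B)" by simp
    then have "complex_of_real (d $ i) = cinner (column i B) (column i B)"
      by (simp add: real_diag_def diag_matrix_def)
    then have "d $ i = (norm (column i B))\<^sup>2"
      unfolding cinner_self of_real_eq_iff .
    moreover have "column i B \<noteq> 0"
      using Binv det_zero_column(1)[of i B] by (auto simp: invertible_det_nz)
    ultimately show ?thesis by simp
  qed
  define h :: "real^'n" where "h = (\<chi> i. ln (d $ i) / 2)"
  have d: "real_diag d = exp_diag (h + h)"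
    using dpos by (simp add: real_diag_def exp_diag_def h_def)
  define K where "K = B ** exp_diag (- h)"
  have "conj_transpose K ** K = exp_diag (- h) ** (conj_transpose B ** B) ** exp_diag (- h)"
    by (simp add: K_def conj_transpose_mult matrix_mul_assoc)
  also have "\<dots> = mat 1" by (simp add: BB d exp_diag_mult)
  finally have K: "unitary_matrix K" by (rule unitaryI)
  have "K ** exp_diag h ** conj_transpose U = B ** (exp_diag (- h) ** exp_diag h) ** conj_transpose U"
    by (simp add: K_def matrix_mul_assoc)
  also have "\<dots> = g ** (U ** conj_transpose U)" 
    by (simp add: exp_diag_mult B_def matrix_mul_assoc)
  finally have "g = K ** exp_diag h ** conj_transpose U" by (simp add: UU)
  then show ?thesis by (rule that[OF K unitary_conj_transpose[OF U]])
qed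

lemma matrix_power_unitary_conj:
  fixes U :: "complex^'n^'n"
  assumes U: "unitary_matrix U"
  shows "(((**) (U ** diag_matrix x ** conj_transpose U)) ^^ k) (mat 1)
    = U ** diag_matrix (\<chi> i. (x $ i) ^ k) ** conj_transpose U"
proof (induction k)
  case 0
  then show ?case using U by (simp add: unitary_matrix_def one_vec_def[symmetric])
next
  case (Suc k)
  have x: "x * (\<chi> i. (x $ i) ^ k) = (\<chi> i. (x $ i) ^ Suc k)" by (simp add: vec_eq_iff)
  have "U ** diag_matrix x ** conj_transpose U
      ** (U ** diag_matrix (\<chi> i. (x $ i) ^ k) ** conj_transpose U)
    = U ** (diag_matrix x ** (conj_transpose U ** U) ** diag_matrix (\<chi> i. (x $ i) ^ k))
        ** conj_transpose U"
    by (simp add: matrix_mul_assoc)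
  also have "\<dots> = U ** diag_matrix (\<chi> i. (x $ i) ^ Suc k) ** conj_transpose U"
    using U by (simp only: unitary_matrix_def matrix_mul_rid diag_matrix_mult x)
  finally show ?case by (simp only: Suc funpow.simps o_apply)
qed

text \<open>
  Together with \<open>hermitian_diagonalization\<close> this computes the exponential of every Hermitian matrix.
  The series is summed entry by entry, where it is a combination of scalar exponential series.
\<close>

lemma matrix_exp_conj_real_diag:
  fixes U :: "complex^'n^'n"
  assumes U: "unitary_matrix U"
  shows "matrix_exp (t *\<^sub>R (U ** real_diag h ** conj_transpose U))
    = U ** exp_diag (t *\<^sub>R h) ** conj_transpose U"
proof -
  define x :: "complex^'n" where "x = (\<chi> i. complex_of_real (t * h $ i))"
  have eq: "t *\<^sub>R (U ** real_diag h ** conj_transpose U) = U ** diag_matrix x ** conj_transpose U"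
    by (simp add: vec_eq_iff real_diag_def mult_diag_mult_entry x_def scaleR_sum_right
        scaleR_conv_of_real[where 'a=complex] sum_distrib_left mult_ac)
  have "(\<lambda>k. (1 / fact k) *\<^sub>R (U ** diag_matrix (\<chi> i. (x $ i) ^ k) ** conj_transpose U)) sums
      (U ** diag_matrix (\<chi> i. exp (x $ i)) ** conj_transpose U)"
    unfolding sums_def
  proof (intro vec_tendstoI)
    fix i j
    have "(\<lambda>k. \<Sum>l\<in>UNIV. U $ i $ l * ((x $ l) ^ k /\<^sub>R fact k) * conj_transpose U $ l $ j) sums
      (\<Sum>l\<in>UNIV. U $ i $ l * exp (x $ l) * conj_transpose U $ l $ j)"
      by (intro sums_sum sums_mult sums_mult2 exp_converges)
    then show "(\<lambda>n. (\<Sum>k<n. (1 / fact k) *\<^sub>R (U ** diag_matrix (\<chi> i. (x $ i) ^ k)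
        ** conj_transpose U)) $ i $ j)
      \<longlonglongrightarrow> (U ** diag_matrix (\<chi> i. exp (x $ i)) ** conj_transpose U) $ i $ j"
      by (simp add: sums_def mult_diag_mult_entry scaleR_sum_right divide_inverse mult_ac)
  qed
  then have "matrix_exp (t *\<^sub>R (U ** real_diag h ** conj_transpose U))
      = U ** diag_matrix (\<chi> i. exp (x $ i)) ** conj_transpose U"
    unfolding matrix_exp_def eq matrix_power_unitary_conj[OF U] by (rule sums_unique[symmetric])
  moreover have "exp (x $ i) = complex_of_real (exp ((t *\<^sub>R h) $ i))" for i
    by (simp only: x_def vec_lambda_beta exp_of_real vector_scaleR_component real_scaleR_def)
  ultimately show ?thesis by (simp only: exp_diag_def)
qed

lemma trace_conj_transpose_mult_self:
  "trace (conj_transpose A ** A) = complex_of_real ((norm A)\<^sup>2)" for A :: "complex^'n^'n"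
proof -
  have "(norm A)\<^sup>2 = (\<Sum>i\<in>UNIV. \<Sum>j\<in>UNIV. (cmod (A $ i $ j))\<^sup>2)"
    by (simp add: norm_matrix_eq_frobenius sum_nonneg)
  also have "\<dots> = (\<Sum>j\<in>UNIV. \<Sum>i\<in>UNIV. (cmod (A $ i $ j))\<^sup>2)" by (rule sum.swap)
  finally show ?thesis
    by (simp add: trace_def conj_transpose_def matrix_matrix_mult_def mult.commute[of "cnj _"]
        complex_norm_square[symmetric])
qed

lemma trace_real_diag: "trace (real_diag h ** real_diag k) = complex_of_real (inner h k)"
  by (simp add: trace_def real_diag_def mult_diag_entry)
     (simp add: diag_matrix_def inner_vec_def)

lemma norm_unitary_conj_real_diag:
  assumes "unitary_matrix U"
  shows "norm (U ** real_diag h ** conj_transpose U) = norm h"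
proof -
  let ?M = "U ** real_diag h ** conj_transpose U"
  have "conj_transpose ?M ** ?M
      = U ** (real_diag h ** (conj_transpose U ** U) ** real_diag h) ** conj_transpose U"
    by (simp add: conj_transpose_mult matrix_mul_assoc)
  also have "\<dots> = U ** (real_diag h ** real_diag h) ** conj_transpose U"
    using assms by (simp only: unitary_matrix_def matrix_mul_rid)
  finally have "trace (conj_transpose ?M ** ?M)
      = trace ((U ** (real_diag h ** real_diag h)) ** conj_transpose U)" by simp
  also have "\<dots> = trace ((conj_transpose U ** U) ** (real_diag h ** real_diag h))"
    by (subst trace_mul_sym) (simp add: matrix_mul_assoc)
  also have "\<dots> = complex_of_real ((norm h)\<^sup>2)"
    using assms by (simp add: unitary_matrix_def trace_real_diag power2_norm_eq_inner)
  finally have "(norm ?M)\<^sup>2 = (norm h)\<^sup>2"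
    unfolding trace_conj_transpose_mult_self of_real_eq_iff .
  then show ?thesis by simp
qed

section \<open>Eigenvalues in nonincreasing order\<close>

lemma ex_antitone_permutation:
  fixes f :: "'n::{finite,linorder} \<Rightarrow> 'b::linorder"
  obtains \<sigma> :: "'n \<Rightarrow> 'n" where "bij \<sigma>" "\<And>i j. i \<le> j \<Longrightarrow> f (\<sigma> j) \<le> f (\<sigma> i)"
proof -
  define L0 where "L0 = sorted_list_of_set (UNIV :: 'n set)"
  define L1 where "L1 = rev (sort_key f L0)"
  define n where "n = length L0"
  have b0: "bij_betw (nth L0) {..<n} UNIV"
    by (rule bij_betw_nth) (auto simp: L0_def n_def)
  have b1: "bij_betw (nth L1) {..<n} UNIV"
    by (rule bij_betw_nth) (auto simp: L0_def L1_def n_def)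
  define idx where "idx = inv_into {..<n} (nth L0)"
  have bi: "bij_betw idx UNIV {..<n}" unfolding idx_def by (rule bij_betw_inv_into[OF b0])
  have idx: "idx i < n" "L0 ! idx i = i" for i
    using bi bij_betw_inv_into_right[OF b0, of i] by (auto simp: idx_def bij_betw_def)
  have "bij (nth L1 \<circ> idx)" using bi b1 by (rule bij_betw_trans)
  moreover have "f ((nth L1 \<circ> idx) j) \<le> f ((nth L1 \<circ> idx) i)" if "i \<le> j" for i j
  proof -
    have "idx i \<le> idx j"
    proof (rule ccontr)
      assume "\<not> idx i \<le> idx j"
      then have "L0 ! idx j < L0 ! idx i"
        using idx(1)[of i] by (intro sorted_wrt_nth_less[of "(<)" L0]) (auto simp: L0_def n_def)
      then show False using that idx by simp
    qed
    moreover have "sorted (rev (map f L1))" by (simp add: L1_def rev_map)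
    ultimately have "map f L1 ! idx j \<le> map f L1 ! idx i"
      using idx(1)[of j] by (intro sorted_rev_nth_mono) (auto simp: L1_def n_def)
    then show ?thesis using idx(1)[of j] idx(1)[of i] by (simp add: L1_def n_def)
  qed
  ultimately show ?thesis using that[of "nth L1 \<circ> idx"] by simp
qed

text \<open>
  The polynomial determines the multiset of its roots, and a multiset has only one nonincreasing
  enumeration.
\<close>

lemma antitone_roots_unique:
  fixes x y :: "real^'n::{finite,linorder}"
  assumes x: "\<And>i j. i \<le> j \<Longrightarrow> x $ j \<le> x $ i" and y: "\<And>i j. i \<le> j \<Longrightarrow> y $ j \<le> y $ i"
    and eq: "\<And>z. (\<Prod>i\<in>UNIV. z - complex_of_real (x $ i)) = (\<Prod>i\<in>UNIV. z - complex_of_real (y $ i))"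
  shows "x = y"
proof -
  define L where "L = sorted_list_of_set (UNIV :: 'n set)"
  have L: "sorted L" "distinct L" "set L = UNIV" by (auto simp: L_def)
  define P :: "(real, 'n) vec \<Rightarrow> complex poly" where
    "P x = (\<Prod>i\<in>UNIV. [:- complex_of_real (x $ i), 1:])" for x
  have "poly (P x) z = poly (P y) z" for z
    using eq[of z] by (simp add: P_def poly_prod)
  then have "P x = P y" by (simp add: poly_eq_poly_eq_iff[symmetric] fun_eq_iff)
  moreover have "proots (P x) = image_mset (\<lambda>i. complex_of_real (x $ i)) (mset_set UNIV)" for x
    unfolding P_def by (subst proots_prod) (auto simp: sum_unfold_sum_mset)
  ultimately have "image_mset (\<lambda>i. complex_of_real (x $ i)) (mset_set UNIV)
      = image_mset (\<lambda>i. complex_of_real (y $ i)) (mset_set UNIV)" by metis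
  then have "image_mset Re (image_mset (\<lambda>i. complex_of_real (x $ i)) (mset_set UNIV))
      = image_mset Re (image_mset (\<lambda>i. complex_of_real (y $ i)) (mset_set UNIV))" by simp
  then have "image_mset (($) x) (mset_set UNIV) = image_mset (($) y) (mset_set UNIV)"
    by (simp add: multiset.map_comp o_def)
  moreover have "mset_set UNIV = mset L" using L mset_set_set by metis
  ultimately have "mset (map (($) x) L) = mset (map (($) y) L)" by simp
  moreover have "sorted (rev (map (($) w) L))" if "\<And>i j. i \<le> j \<Longrightarrow> w $ j \<le> w $ i" for w :: "(real, 'n) vec"
    unfolding sorted_rev_iff_nth_mono using that sorted_nth_mono[OF L(1)] by simp
  ultimately have "rev (map (($) x) L) = rev (map (($) y) L)"
    using x y by (metis mset_rev properties_for_sort)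
  then have "x $ i = y $ i" for i using L(3) by auto
  then show ?thesis by (simp add: vec_eq_iff)
qed

lemma spec_eqI:
  assumes "\<And>i j. i \<le> j \<Longrightarrow> x $ j \<le> x $ i"
    and "\<And>z. det (mat z - A) = (\<Prod>i\<in>UNIV. z - complex_of_real (x $ i))"
  shows "spec A = x"
  unfolding spec_def by (rule the_equality) (use assms in \<open>auto intro!: antitone_roots_unique\<close>)

text \<open>
  The entries of \<open>spec M\<close> are the diagonal entries of a unitary diagonalization of \<open>M\<close> in another
  order, and unitary conjugation preserves the Frobenius norm.
\<close>

lemma norm_spec_hermitian:
  fixes M :: "complex^'n::{finite,linorder}^'n::{finite,linorder}"
  assumes "hermitian_matrix M"
  shows "norm (spec M) = norm M"
proof -
  obtain U h where U: "unitary_matrix U" and M: "M = U ** real_diag h ** conj_transpose U"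
    using assms by (rule hermitian_diagonalization)
  have UU: "U ** conj_transpose U = mat 1" using U by (simp add: unitary_matrix_def)
  obtain \<sigma> :: "'n \<Rightarrow> 'n" where \<sigma>: "bij \<sigma>" "\<And>i j. i \<le> j \<Longrightarrow> h $ \<sigma> j \<le> h $ \<sigma> i"
    using ex_antitone_permutation[of "\<lambda>i. h $ i"] by blast
  define x :: "(real, 'n) vec" where "x = (\<chi> i. h $ \<sigma> i)"
  have "spec M = x"
  proof (rule spec_eqI)
    show "x $ j \<le> x $ i" if "i \<le> j" for i j using \<sigma> that by (simp add: x_def)
    fix z :: complex
    have "U ** mat z ** conj_transpose U = mat z"
    proof -
      have z: "mat z = diag_matrix (\<chi> i. z)" by (simp add: mat_def diag_matrix_def vec_eq_iff)
      have "U ** mat z = mat z ** U"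
        unfolding z vec_eq_iff
        by (simp add: mult_diag_entry diag_mult_entry mult.commute)
      then show ?thesis using UU by (metis matrix_mul_assoc matrix_mul_rid)
    qed
    moreover have "U ** (mat z - real_diag h) ** conj_transpose U
        = U ** mat z ** conj_transpose U - U ** real_diag h ** conj_transpose U"
      by (simp add: matrix_matrix_mult_def vec_eq_iff left_diff_distrib right_diff_distrib sum_subtractf)
    ultimately have "mat z - M = U ** (mat z - real_diag h) ** conj_transpose U"
      by (simp add: M)
    then have "det (mat z - M) = det (U ** conj_transpose U) * det (mat z - real_diag h)"
      by (simp add: det_mul)
    also have "\<dots> = (\<Prod>i\<in>UNIV. (mat z - real_diag h) $ i $ i)"
      using UU det_diagonal[of "mat z - real_diag h"]
      by (simp add: mat_def[of z] real_diag_def diag_matrix_def)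
    also have "\<dots> = (\<Prod>i\<in>UNIV. z - complex_of_real (h $ i))"
      by (simp add: mat_def real_diag_def diag_matrix_def)
    also have "\<dots> = (\<Prod>i\<in>UNIV. z - complex_of_real (x $ i))"
      unfolding x_def vec_lambda_beta
      by (rule prod.reindex_bij_betw[OF \<sigma>(1), symmetric])
    finally show "det (mat z - M) = (\<Prod>i\<in>UNIV. z - complex_of_real (x $ i))" .
  qed
  moreover have "norm x = norm h"
  proof -
    have "(\<Sum>i\<in>UNIV. (norm (h $ \<sigma> i))\<^sup>2) = (\<Sum>i\<in>UNIV. (norm (h $ i))\<^sup>2)"
      by (rule sum.reindex_bij_betw[OF \<sigma>(1)])
    then show ?thesis by (simp add: norm_vec_def L2_set_def x_def)
  qed
  ultimately show ?thesis using norm_unitary_conj_real_diag[OF U] M by simp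
qed

section \<open>Exponential sums\<close>

lemma exp_quadratic_bound:
  fixes x :: real assumes "\<bar>x\<bar> \<le> 1" shows "exp x \<le> 1 + x + x\<^sup>2"
proof (cases "0 \<le> x")
  case True then show ?thesis using exp_bound[of x] assms by simp
next
  case False
  define y where "y = - x"
  have y: "0 < y" using False by (simp add: y_def)
  have "exp (- y) \<le> 1 / (1 + y)"
    using y exp_ge_add_one_self[of y] by (simp add: exp_minus field_simps)
  also have "\<dots> \<le> 1 - y + y\<^sup>2"
  proof -
    have "(1 - y + y\<^sup>2) * (1 + y) = 1 + y ^ 3" by (simp add: power2_eq_square power3_eq_cube algebra_simps)
    also have "\<dots> \<ge> 1" using y by simp
    finally show ?thesis using y by (simp add: divide_le_eq)
  qed
  finally show ?thesis by (simp add: y_def)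
qed

text \<open>
  Induction on the support \<open>\<Gamma>\<close> of the weight function \<open>r\<close>. If \<open>0\<close> is a convex combination of \<open>\<Gamma>\<close>,
  subtract from \<open>r\<close> the largest multiple of its coefficients that keeps \<open>r\<close> nonnegative. This
  removes a point from the support and does not change \<open>\<Sum> r \<omega>\<close>. The subtracted part has mean
  zero, so by \<open>1 + x \<le> exp x\<close> it contributes at least its total mass to the exponential sum.
  If \<open>0\<close> is not in the convex hull of \<open>\<Gamma>\<close>, the mean of \<open>r\<close> has norm at least \<open>\<gamma>\<close>, so the left-hand
  side is at most zero.
\<close>

lemma exp_sum_lower_bound:
  fixes \<Omega> :: "'a::euclidean_space set" and r :: "'a \<Rightarrow> real"
  assumes fin: "finite \<Omega>" and \<gamma>: "0 < \<gamma>"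
    and margin: "\<And>\<Gamma> y. \<Gamma> \<subseteq> \<Omega> \<Longrightarrow> 0 \<notin> convex hull \<Gamma> \<Longrightarrow> y \<in> convex hull \<Gamma> \<Longrightarrow> \<gamma> \<le> norm y"
    and "\<And>\<omega>. \<omega> \<in> \<Omega> \<Longrightarrow> 0 \<le> r \<omega>"
  shows "sum r \<Omega> - norm (\<Sum>\<omega>\<in>\<Omega>. r \<omega> *\<^sub>R \<omega>) / \<gamma> \<le> (\<Sum>\<omega>\<in>\<Omega>. r \<omega> * exp (inner h \<omega>))"
  using assms(4)
proof (induction "card {\<omega>\<in>\<Omega>. r \<omega> \<noteq> 0}" arbitrary: r rule: less_induct)
  case less
  define \<Gamma> where "\<Gamma> = {\<omega>\<in>\<Omega>. r \<omega> \<noteq> 0}"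
  have \<Gamma>: "finite \<Gamma>" "\<Gamma> \<subseteq> \<Omega>" using fin by (auto simp: \<Gamma>_def)
  have restrict: "(\<Sum>\<omega>\<in>\<Omega>. r \<omega>) = sum r \<Gamma>" "(\<Sum>\<omega>\<in>\<Omega>. r \<omega> *\<^sub>R \<omega>) = (\<Sum>\<omega>\<in>\<Gamma>. r \<omega> *\<^sub>R \<omega>)"
    by (rule sum.mono_neutral_right; use fin in \<open>auto simp: \<Gamma>_def\<close>)+
  have pos: "0 < r \<omega>" if "\<omega> \<in> \<Gamma>" for \<omega> using less.prems[of \<omega>] that by (auto simp: \<Gamma>_def)
  have exp_nonneg: "0 \<le> (\<Sum>\<omega>\<in>\<Omega>. r \<omega> * exp (inner h \<omega>))"
    by (intro sum_nonneg mult_nonneg_nonneg less.prems) auto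
  consider "\<Gamma> = {}" | "\<Gamma> \<noteq> {}" "0 \<notin> convex hull \<Gamma>" | "0 \<in> convex hull \<Gamma>" by blast
  then show ?case
  proof cases
    case 1
    then have "sum r \<Omega> - norm (\<Sum>\<omega>\<in>\<Omega>. r \<omega> *\<^sub>R \<omega>) / \<gamma> = 0" by (simp add: restrict)
    with exp_nonneg show ?thesis by simp
  next
    case 2
    define s where "s = sum r \<Gamma>"
    have s: "0 < s" unfolding s_def by (rule sum_pos) (use 2 \<Gamma> pos in auto)
    have "(\<Sum>\<omega>\<in>\<Gamma>. (r \<omega> / s) *\<^sub>R \<omega>) \<in> convex hull \<Gamma>"
      unfolding convex_hull_finite[OF \<Gamma>(1)]
      using s pos by (auto intro!: exI[of _ "\<lambda>\<omega>. r \<omega> / s"] less_imp_le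
          simp: sum_divide_distrib[symmetric] s_def[symmetric])
    then have "\<gamma> \<le> norm (\<Sum>\<omega>\<in>\<Gamma>. (r \<omega> / s) *\<^sub>R \<omega>)" by (rule margin[OF \<Gamma>(2) 2(2)])
    also have "(\<Sum>\<omega>\<in>\<Gamma>. (r \<omega> / s) *\<^sub>R \<omega>) = (1 / s) *\<^sub>R (\<Sum>\<omega>\<in>\<Gamma>. r \<omega> *\<^sub>R \<omega>)"
      by (simp add: scaleR_sum_right)
    finally have "s \<le> norm (\<Sum>\<omega>\<in>\<Gamma>. r \<omega> *\<^sub>R \<omega>) / \<gamma>"
      using s \<gamma> by (simp add: field_simps)
    with exp_nonneg show ?thesis by (simp add: restrict s_def)
  next
    case 3
    then obtain c0 where c0: "\<forall>\<omega>\<in>\<Gamma>. 0 \<le> c0 \<omega>" "sum c0 \<Gamma> = 1" "(\<Sum>\<omega>\<in>\<Gamma>. c0 \<omega> *\<^sub>R \<omega>) = 0"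
      unfolding convex_hull_finite[OF \<Gamma>(1)] by auto
    define c where "c \<omega> = (if \<omega> \<in> \<Gamma> then c0 \<omega> else 0)" for \<omega>
    have c_nonneg: "0 \<le> c \<omega>" for \<omega> using c0 by (simp add: c_def)
    have c: "sum c \<Omega> = 1" "(\<Sum>\<omega>\<in>\<Omega>. c \<omega> *\<^sub>R \<omega>) = 0"
    proof -
      have "sum c \<Omega> = sum c \<Gamma>" "(\<Sum>\<omega>\<in>\<Omega>. c \<omega> *\<^sub>R \<omega>) = (\<Sum>\<omega>\<in>\<Gamma>. c \<omega> *\<^sub>R \<omega>)"
        by (rule sum.mono_neutral_right; use fin \<Gamma> in \<open>auto simp: c_def\<close>)+
      with c0 show "sum c \<Omega> = 1" "(\<Sum>\<omega>\<in>\<Omega>. c \<omega> *\<^sub>R \<omega>) = 0" by (simp_all add: c_def)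
    qed
    \<comment> \<open>The minimal ratio \<open>r / c\<close> is the largest admissible multiple, and its minimizer leaves the support.\<close>
    define B where "B = {\<omega>\<in>\<Gamma>. c \<omega> \<noteq> 0}"
    have "B \<noteq> {}"
    proof
      assume "B = {}"
      then have "c \<omega> = 0" for \<omega> by (auto simp: B_def c_def)
      then show False using c(1) by simp
    qed
    moreover have B: "finite B" using \<Gamma> by (simp add: B_def)
    ultimately obtain w where w: "w \<in> B" "\<And>\<omega>. \<omega> \<in> B \<Longrightarrow> r w / c w \<le> r \<omega> / c \<omega>"
      using ex_min_if_finite[of "(\<lambda>\<omega>. r \<omega> / c \<omega>) ` B"] by (auto simp: not_less)
    define t where "t = r w / c w"
    define r' where "r' \<omega> = r \<omega> - t * c \<omega>" for \<omega>
    have t: "0 \<le> t" using w c_nonneg[of w] pos[of w] by (auto simp: t_def B_def)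
    have r'_nonneg: "0 \<le> r' \<omega>" if "\<omega> \<in> \<Omega>" for \<omega>
    proof (cases "\<omega> \<in> B")
      case True
      then have "0 < c \<omega>" using c_nonneg[of \<omega>] by (simp add: B_def)
      then show ?thesis using w(2)[OF True] by (simp add: r'_def t_def field_simps)
    next
      case False
      then have "c \<omega> = 0" by (auto simp: B_def c_def)
      then show ?thesis using less.prems[OF that] by (simp add: r'_def)
    qed
    have "{\<omega>\<in>\<Omega>. r' \<omega> \<noteq> 0} \<subset> \<Gamma>"
    proof
      show "{\<omega>\<in>\<Omega>. r' \<omega> \<noteq> 0} \<subseteq> \<Gamma>" by (auto simp: r'_def \<Gamma>_def c_def)
      have "r' w = 0" "w \<in> \<Gamma>" using w(1) by (auto simp: r'_def t_def B_def)
      then show "{\<omega>\<in>\<Omega>. r' \<omega> \<noteq> 0} \<noteq> \<Gamma>" by blast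
    qed
    then have "card {\<omega>\<in>\<Omega>. r' \<omega> \<noteq> 0} < card {\<omega>\<in>\<Omega>. r \<omega> \<noteq> 0}"
      using \<Gamma>(1) psubset_card_mono unfolding \<Gamma>_def by blast
    from less.hyps[OF this r'_nonneg]
    have IH: "sum r' \<Omega> - norm (\<Sum>\<omega>\<in>\<Omega>. r' \<omega> *\<^sub>R \<omega>) / \<gamma> \<le> (\<Sum>\<omega>\<in>\<Omega>. r' \<omega> * exp (inner h \<omega>))" .
    have "sum r' \<Omega> = sum r \<Omega> - t"
      using c(1) by (simp add: r'_def sum_subtractf sum_distrib_left[symmetric])
    moreover have "(\<Sum>\<omega>\<in>\<Omega>. r' \<omega> *\<^sub>R \<omega>) = (\<Sum>\<omega>\<in>\<Omega>. r \<omega> *\<^sub>R \<omega>)"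
    proof -
      have "(\<Sum>\<omega>\<in>\<Omega>. r' \<omega> *\<^sub>R \<omega>) = (\<Sum>\<omega>\<in>\<Omega>. r \<omega> *\<^sub>R \<omega>) - t *\<^sub>R (\<Sum>\<omega>\<in>\<Omega>. c \<omega> *\<^sub>R \<omega>)"
        by (simp add: r'_def scaleR_diff_left sum_subtractf scaleR_sum_right)
      then show ?thesis by (simp add: c(2))
    qed
    moreover have "(\<Sum>\<omega>\<in>\<Omega>. r' \<omega> * exp (inner h \<omega>))
        = (\<Sum>\<omega>\<in>\<Omega>. r \<omega> * exp (inner h \<omega>)) - t * (\<Sum>\<omega>\<in>\<Omega>. c \<omega> * exp (inner h \<omega>))"
      by (simp add: r'_def sum_subtractf sum_distrib_left algebra_simps)
    moreover have "1 \<le> (\<Sum>\<omega>\<in>\<Omega>. c \<omega> * exp (inner h \<omega>))"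
    proof -
      have "1 = sum c \<Omega> + inner h (\<Sum>\<omega>\<in>\<Omega>. c \<omega> *\<^sub>R \<omega>)" by (simp add: c)
      also have "\<dots> = (\<Sum>\<omega>\<in>\<Omega>. c \<omega> * (1 + inner h \<omega>))"
        by (simp add: inner_sum_right sum.distrib algebra_simps)
      also have "\<dots> \<le> (\<Sum>\<omega>\<in>\<Omega>. c \<omega> * exp (inner h \<omega>))"
        by (intro sum_mono mult_left_mono c_nonneg exp_ge_add_one_self)
      finally show ?thesis .
    qed
    ultimately show ?thesis using IH t mult_left_mono[of 1 _ t] by fastforce
  qed
qed

lemma exp_sum_lower_bound_image:
  fixes f :: "'i \<Rightarrow> 'a::euclidean_space" and r :: "'i \<Rightarrow> real"
  assumes fin: "finite \<Omega>" and inj: "inj_on f \<Omega>" and \<gamma>: "0 < \<gamma>"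
    and margin: "\<And>\<Gamma> y. \<Gamma> \<subseteq> \<Omega> \<Longrightarrow> 0 \<notin> convex hull (f ` \<Gamma>) \<Longrightarrow> y \<in> convex hull (f ` \<Gamma>) \<Longrightarrow> \<gamma> \<le> norm y"
    and r: "\<And>\<omega>. \<omega> \<in> \<Omega> \<Longrightarrow> 0 \<le> r \<omega>"
  shows "sum r \<Omega> - norm (\<Sum>\<omega>\<in>\<Omega>. r \<omega> *\<^sub>R f \<omega>) / \<gamma> \<le> (\<Sum>\<omega>\<in>\<Omega>. r \<omega> * exp (inner h (f \<omega>)))"
proof -
  define r' where "r' = r \<circ> the_inv_into \<Omega> f"
  have r': "r' (f \<omega>) = r \<omega>" if "\<omega> \<in> \<Omega>" for \<omega>
    using inj that by (simp add: r'_def the_inv_into_f_f)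
  have "sum r' (f ` \<Omega>) - norm (\<Sum>\<omega>\<in>f ` \<Omega>. r' \<omega> *\<^sub>R \<omega>) / \<gamma> \<le> (\<Sum>\<omega>\<in>f ` \<Omega>. r' \<omega> * exp (inner h \<omega>))"
  proof (rule exp_sum_lower_bound)
    show "\<gamma> \<le> norm y" if "\<Gamma> \<subseteq> f ` \<Omega>" "0 \<notin> convex hull \<Gamma>" "y \<in> convex hull \<Gamma>" for \<Gamma> y
      using that margin by (metis subset_image_iff)
  qed (use fin \<gamma> r r' in auto)
  then show ?thesis by (simp add: sum.reindex[OF inj] r' o_def)
qed

section \<open>Characters of the torus and Laurent polynomials\<close>

definition character :: "int^'n \<Rightarrow> complex^'n \<Rightarrow> complex" where
  "character \<omega> x = (\<Prod>i\<in>UNIV. (x $ i) powi (\<omega> $ i))"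

lemma character_mult: "character \<omega> (x * y) = character \<omega> x * character \<omega> y"
  by (simp add: character_def power_int_mult_distrib prod.distrib)

lemma character_add:
  "\<forall>i. x $ i \<noteq> 0 \<Longrightarrow> character (\<omega> + \<nu>) x = character \<omega> x * character \<nu> x"
  by (simp add: character_def power_int_add prod.distrib)

lemma character_one [simp]: "character \<omega> 1 = 1"
  by (simp add: character_def)

lemma character_nonzero: "\<forall>i. x $ i \<noteq> 0 \<Longrightarrow> character \<omega> x \<noteq> 0"
  by (simp add: character_def)

lemma character_exp:
  "character \<omega> (\<chi> i. complex_of_real (exp (h $ i)))
    = complex_of_real (exp (inner h (real_weight \<omega>)))"
proof -
  have "complex_of_real (exp a) powi k = complex_of_real (exp (a * real_of_int k))" for a k
    by (simp add: exp_power_int mult.commute flip: of_real_power_int)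
  then have "character \<omega> (\<chi> i. complex_of_real (exp (h $ i)))
      = (\<Prod>i\<in>UNIV. complex_of_real (exp (h $ i * real_of_int (\<omega> $ i))))"
    by (simp only: character_def vec_lambda_beta)
  also have "\<dots> = complex_of_real (exp (inner h (real_weight \<omega>)))"
    by (simp add: inner_vec_def real_weight_def exp_sum)
  finally show ?thesis .
qed

lemma character_diag_single:
  "character \<omega> (\<chi> i. if i = k then c else 1) = c powi (\<omega> $ k)"
proof -
  have "character \<omega> (\<chi> i. if i = k then c else 1) = (\<Prod>i\<in>UNIV. if i = k then c powi (\<omega> $ k) else 1)"
    unfolding character_def by (intro prod.cong) auto
  then show ?thesis by simp
qed

text \<open>
  Choosing \<open>x\<close> in the compact torus serves two purposes: it shows that characters are linearly
  independent, and that weight spaces of different weights are orthogonal.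
\<close>

lemma characters_separated:
  fixes \<omega> \<nu> :: "int^'n"
  assumes "\<omega> \<noteq> \<nu>"
  obtains x where "\<forall>i. cmod (x $ i) = 1" "character \<omega> x \<noteq> character \<nu> x"
proof -
  obtain k where k: "\<omega> $ k \<noteq> \<nu> $ k" using assms by (auto simp: vec_eq_iff)
  define d where "d = \<omega> $ k - \<nu> $ k"
  \<comment> \<open>Chosen with \<open>c\<^sup>d = -1\<close>, so that the two characters differ by a sign.\<close>
  define c where "c = cis (pi / of_int d)"
  define x :: "complex^'n" where "x = (\<chi> i. if i = k then c else 1)"
  have "c powi d = -1" using k by (simp add: c_def cis_power_int d_def)
  moreover have "c powi (\<omega> $ k) = c powi d * c powi (\<nu> $ k)"
    by (simp add: d_def c_def flip: power_int_add)
  ultimately have "character \<omega> x = - character \<nu> x"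
    by (simp add: x_def character_diag_single)
  moreover have "character \<nu> x \<noteq> 0" by (rule character_nonzero) (simp add: x_def c_def)
  ultimately have "character \<omega> x \<noteq> character \<nu> x" by simp
  moreover have "\<forall>i. cmod (x $ i) = 1" by (simp add: x_def c_def)
  ultimately show ?thesis by (rule that[rotated])
qed


text \<open>
  Laurent polynomials on the torus with coefficients in a complex vector space. The vector-valued
  form covers both coordinate functions, with \<open>sc\<close> the multiplication of complex numbers, and
  orbit maps of the torus.
\<close>

definition laurent ::
    "(complex \<Rightarrow> 'v \<Rightarrow> 'v) \<Rightarrow> (complex^'n \<Rightarrow> 'v::ab_group_add) \<Rightarrow> bool" where
  "laurent sc F \<longleftrightarrow> (\<exists>S u. finite S \<and>
     (\<forall>x. (\<forall>i. x $ i \<noteq> 0) \<longrightarrow> F x = (\<Sum>\<omega>\<in>S. sc (character \<omega> x) (u \<omega>))))"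

locale complex_vector_space = vector_space scaleC
  for scaleC :: "complex \<Rightarrow> 'v::ab_group_add \<Rightarrow> 'v"
begin

text \<open>
  The argument of Dedekind: replacing \<open>x\<close> by \<open>x y\<close> and subtracting \<open>\<nu>(y)\<close> times the original
  relation gives a relation without \<open>\<nu>\<close>, with coefficients multiplied by \<open>\<omega>(y) - \<nu>(y)\<close>.
\<close>

lemma characters_independent:
  fixes S :: "(int^'n) set"
  assumes "finite S"
    and "\<And>x. \<forall>i. x $ i \<noteq> 0 \<Longrightarrow> (\<Sum>\<omega>\<in>S. scaleC (character \<omega> x) (u \<omega>)) = 0"
    and "\<omega> \<in> S"
  shows "u \<omega> = 0"
  using assms
proof (induction S arbitrary: u \<omega> rule: finite_induct)
  case empty
  then show ?case by simp
next
  case (insert \<nu> S)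
  have zero: "scaleC (character \<nu> x) (u \<nu>) + (\<Sum>\<omega>\<in>S. scaleC (character \<omega> x) (u \<omega>)) = 0"
    if "\<forall>i. x $ i \<noteq> 0" for x
    using insert.prems(1)[OF that] insert.hyps by simp
  have S: "u \<omega> = 0" if \<omega>: "\<omega> \<in> S" for \<omega>
  proof -
    obtain y where y1: "\<forall>i. cmod (y $ i) = 1" and sep: "character \<omega> y \<noteq> character \<nu> y"
      using characters_separated[of \<omega> \<nu>] \<omega> insert.hyps by blast
    have y: "\<forall>i. y $ i \<noteq> 0" using y1 by (metis norm_zero zero_neq_one)
    have "scaleC (character \<omega> y - character \<nu> y) (u \<omega>) = 0"
    proof (rule insert.IH[OF _ \<omega>])
      fix x :: "complex^'n" assume x: "\<forall>i. x $ i \<noteq> 0"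
      have "scaleC (character \<nu> y) (scaleC (character \<nu> x) (u \<nu>)
          + (\<Sum>\<omega>\<in>S. scaleC (character \<omega> x) (u \<omega>))) = 0"
        using zero[OF x] by simp
      moreover have "scaleC (character \<nu> (x * y)) (u \<nu>)
          + (\<Sum>\<omega>\<in>S. scaleC (character \<omega> (x * y)) (u \<omega>)) = 0"
        using x y by (intro zero) simp
      moreover have "(\<Sum>\<omega>\<in>S. scaleC (character \<omega> x) (scaleC (character \<omega> y - character \<nu> y) (u \<omega>)))
        = (scaleC (character \<nu> (x * y)) (u \<nu>) + (\<Sum>\<omega>\<in>S. scaleC (character \<omega> (x * y)) (u \<omega>)))
          - scaleC (character \<nu> y) (scaleC (character \<nu> x) (u \<nu>)
          + (\<Sum>\<omega>\<in>S. scaleC (character \<omega> x) (u \<omega>)))"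
        by (simp add: character_mult scale_right_distrib scale_sum_right mult.commute
            right_diff_distrib scale_right_diff_distrib scale_left_diff_distrib sum_subtractf)
      ultimately show "(\<Sum>\<omega>\<in>S. scaleC (character \<omega> x)
          (scaleC (character \<omega> y - character \<nu> y) (u \<omega>))) = 0" by simp
    qed
    then show ?thesis using sep by simp
  qed
  have "u \<nu> = 0" using zero[of 1] S by simp
  then show ?case using S insert.prems(2) by auto
qed

lemma laurent_zero: "laurent scaleC (\<lambda>x. 0)"
  unfolding laurent_def by (intro exI[of _ "{}"]) auto

lemma laurent_character: "laurent scaleC (\<lambda>x. scaleC (character \<omega> x) u)"
  unfolding laurent_def by (intro exI[of _ "{\<omega>}"] exI[of _ "\<lambda>_. u"]) auto

lemma laurent_add:
  assumes "laurent scaleC F" "laurent scaleC G"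
  shows "laurent scaleC (\<lambda>x. F x + G x)"
proof -
  obtain S u where S: "finite S"
    and F: "\<And>x. \<forall>i. x $ i \<noteq> 0 \<Longrightarrow> F x = (\<Sum>\<omega>\<in>S. scaleC (character \<omega> x) (u \<omega>))"
    using assms(1) unfolding laurent_def by blast
  obtain T w where T: "finite T"
    and G: "\<And>x. \<forall>i. x $ i \<noteq> 0 \<Longrightarrow> G x = (\<Sum>\<omega>\<in>T. scaleC (character \<omega> x) (w \<omega>))"
    using assms(2) unfolding laurent_def by blast
  \<comment> \<open>Exponents occurring in both expansions get the sum of the two coefficients.\<close>
  define z where "z \<omega> = (if \<omega> \<in> S then u \<omega> else 0) + (if \<omega> \<in> T then w \<omega> else 0)" for \<omega>
  have "F x + G x = (\<Sum>\<omega>\<in>S \<union> T. scaleC (character \<omega> x) (z \<omega>))" if x: "\<forall>i. x $ i \<noteq> 0" for x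
  proof -
    have "F x = (\<Sum>\<omega>\<in>S \<union> T. scaleC (character \<omega> x) (if \<omega> \<in> S then u \<omega> else 0))"
      unfolding F[OF x] by (rule sum.mono_neutral_cong_left) (use S T in auto)
    moreover have "G x = (\<Sum>\<omega>\<in>S \<union> T. scaleC (character \<omega> x) (if \<omega> \<in> T then w \<omega> else 0))"
      unfolding G[OF x] by (rule sum.mono_neutral_cong_left) (use S T in auto)
    ultimately show ?thesis by (simp add: z_def scale_right_distrib sum.distrib)
  qed
  then show ?thesis unfolding laurent_def using S T by blast
qed

lemma laurent_sum:
  assumes "\<And>i. i \<in> I \<Longrightarrow> laurent scaleC (F i)"
  shows "laurent scaleC (\<lambda>x. \<Sum>i\<in>I. F i x)"
  using assms
  by (induction I rule: infinite_finite_induct) (auto intro: laurent_zero laurent_add)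

lemma laurent_cong:
  assumes "laurent scaleC F" "\<And>x. \<forall>i. x $ i \<noteq> 0 \<Longrightarrow> F x = G x"
  shows "laurent scaleC G"
  using assms unfolding laurent_def by metis

end

interpretation complex_over_itself: complex_vector_space "(*) :: complex \<Rightarrow> complex \<Rightarrow> complex"
  by unfold_locales

lemma (in complex_vector_space) laurent_scale:
  fixes f :: "complex^'n \<Rightarrow> complex"
  assumes "laurent (*) f" "laurent scaleC G"
  shows "laurent scaleC (\<lambda>x. scaleC (f x) (G x))"
proof -
  obtain S a where S: "finite S"
    and f: "\<And>x. \<forall>i. x $ i \<noteq> 0 \<Longrightarrow> f x = (\<Sum>\<omega>\<in>S. character \<omega> x * a \<omega>)"
    using assms(1) unfolding laurent_def by blast
  obtain T w where T: "finite T"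
    and G: "\<And>x. \<forall>i. x $ i \<noteq> 0 \<Longrightarrow> G x = (\<Sum>\<nu>\<in>T. scaleC (character \<nu> x) (w \<nu>))"
    using assms(2) unfolding laurent_def by blast
  have "laurent scaleC (\<lambda>x. \<Sum>\<omega>\<in>S. \<Sum>\<nu>\<in>T. scaleC (character (\<omega> + \<nu>) x) (scaleC (a \<omega>) (w \<nu>)))"
    by (intro laurent_sum laurent_character)
  then show ?thesis
  proof (rule laurent_cong)
    fix x :: "complex^'n" assume x: "\<forall>i. x $ i \<noteq> 0"
    show "(\<Sum>\<omega>\<in>S. \<Sum>\<nu>\<in>T. scaleC (character (\<omega> + \<nu>) x) (scaleC (a \<omega>) (w \<nu>))) = scaleC (f x) (G x)"
      unfolding f[OF x] G[OF x] scale_sum_left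
      by (simp add: scale_sum_right character_add[OF x] mult_ac)
  qed
qed

lemma regular_function_laurent:
  assumes "regular_function p"
  shows "laurent (*) (\<lambda>x. p (diag_matrix x))"
  using assms
proof induction
  case (const c)
  then show ?case
    using complex_over_itself.laurent_character[of 0 c] by (simp add: character_def)
next
  case (entry i j)
  show ?case
  proof (cases "i = j")
    case True
    have "(\<Prod>k\<in>UNIV. (x $ k) powi (axis i 1 $ k)) = (\<Prod>k\<in>UNIV. if k = i then x $ i else 1)"
      for x :: "complex^'a"
      by (intro prod.cong) (auto simp: axis_def)
    then show ?thesis
      using True complex_over_itself.laurent_character[of "axis i 1" 1]
      by (simp add: character_def diag_matrix_def)
  next
    case False
    then show ?thesis
      using complex_over_itself.laurent_zero by (simp add: diag_matrix_def)
  qed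
next
  case inverse_det
  have "det (diag_matrix x) = (\<Prod>k\<in>UNIV. x $ k)" for x :: "complex^'a"
    by (subst det_diagonal) (simp_all add: diag_matrix_def)
  then show ?case
    using complex_over_itself.laurent_character[of "- 1" 1]
    by (simp add: character_def power_int_minus prod_inversef[symmetric] o_def)
next
  case (add p q)
  then show ?case by (intro complex_over_itself.laurent_add)
next
  case (mult p q)
  then show ?case by (intro complex_over_itself.laurent_scale)
qed

lemma regular_function_sum:
  assumes "\<And>i. i \<in> I \<Longrightarrow> regular_function (p i)"
  shows "regular_function (\<lambda>g. \<Sum>i\<in>I. p i g)"
  using assms
  by (induction I rule: infinite_finite_induct)
     (auto intro: regular_function.const regular_function.add)

section \<open>Weight decomposition\<close>

context rational_representation
begin

sublocale complex_vector_space scaleC ..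

lemma rep_add: "invertible g \<Longrightarrow> \<pi> g (x + y) = \<pi> g x + \<pi> g y"
  using linear_rep[of g] unfolding Vector_Spaces.linear_iff by blast

lemma rep_scale: "invertible g \<Longrightarrow> \<pi> g (scaleC c x) = scaleC c (\<pi> g x)"
  using linear_rep[of g] unfolding Vector_Spaces.linear_iff by blast

lemma rep_zero [simp]: "invertible g \<Longrightarrow> \<pi> g 0 = 0"
  using rep_scale[of g 0 0] by simp

lemma rep_diff: "invertible g \<Longrightarrow> \<pi> g (x - y) = \<pi> g x - \<pi> g y"
  using rep_add[of g "x - y" y] by simp

lemma rep_sum: "invertible g \<Longrightarrow> \<pi> g (\<Sum>i\<in>I. f i) = (\<Sum>i\<in>I. \<pi> g (f i))"
  by (induction I rule: infinite_finite_induct) (auto simp: rep_add)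

lemma rep_regular_coordinates:
  obtains p where "\<And>c. c \<in> Basis \<Longrightarrow> regular_function (p c)"
    "\<And>g. invertible g \<Longrightarrow> \<pi> g w = (\<Sum>c\<in>Basis. scaleC (p c g) c)"
proof -
  obtain q where q: "\<And>b c. b \<in> Basis \<Longrightarrow> c \<in> Basis \<Longrightarrow> regular_function (q b c) \<and>
      (\<forall>g. invertible g \<longrightarrow> representation Basis (\<pi> g b) c = q b c g)"
    using rational_entries by metis
  have coords: "(\<Sum>b\<in>Basis. scaleC (representation Basis x b) b) = x" for x
    using independent_Basis span_Basis finite_Basis by (intro sum_representation_eq) auto
  define p where "p c g = (\<Sum>b\<in>Basis. representation Basis w b * q b c g)" for c g
  have "regular_function (p c)" if "c \<in> Basis" for c
    unfolding p_def using q that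
    by (intro regular_function_sum regular_function.mult regular_function.const) auto
  moreover have "\<pi> g w = (\<Sum>c\<in>Basis. scaleC (p c g) c)" if g: "invertible g" for g
  proof -
    have "\<pi> g w = (\<Sum>b\<in>Basis. scaleC (representation Basis w b) (\<pi> g b))"
      by (subst coords[of w, symmetric]) (simp add: rep_sum rep_scale g)
    also have "\<dots> = (\<Sum>b\<in>Basis. scaleC (representation Basis w b) (\<Sum>c\<in>Basis. scaleC (q b c g) c))"
      using q g by (intro sum.cong refl) (subst coords[symmetric], simp)
    also have "\<dots> = (\<Sum>b\<in>Basis. \<Sum>c\<in>Basis. scaleC (representation Basis w b * q b c g) c)"
      by (simp add: scale_sum_right)
    also have "\<dots> = (\<Sum>c\<in>Basis. \<Sum>b\<in>Basis. scaleC (representation Basis w b * q b c g) c)"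
      by (rule sum.swap)
    finally show ?thesis by (simp add: p_def scale_sum_left)
  qed
  ultimately show ?thesis by (rule that)
qed

lemma rep_torus_laurent: "laurent scaleC (\<lambda>x. \<pi> (diag_matrix x) w)"
proof -
  obtain p where p: "\<And>c. c \<in> Basis \<Longrightarrow> regular_function (p c)"
    "\<And>g. invertible g \<Longrightarrow> \<pi> g w = (\<Sum>c\<in>Basis. scaleC (p c g) c)"
    by (rule rep_regular_coordinates[of w]) blast
  have const: "laurent scaleC (\<lambda>x :: complex^'n. c)" for c
    using laurent_character[of 0 c] by (simp add: character_def)
  have "laurent scaleC (\<lambda>x. \<Sum>c\<in>Basis. scaleC (p c (diag_matrix x)) c)"
    by (intro laurent_sum laurent_scale regular_function_laurent p const)
  then show ?thesis by (rule laurent_cong) (simp add: p invertible_diag_matrix)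
qed

text \<open>
  Expand the orbit map of \<open>w\<close> as a Laurent polynomial. Comparing the coefficients of
  \<open>\<pi>(y) \<pi>(x) w = \<pi>(x y) w\<close> as functions of \<open>x\<close> shows that the coefficients are weight vectors.
\<close>

lemma torus_expansion:
  obtains S u where "finite S" "\<And>\<omega>. \<omega> \<in> S \<Longrightarrow> u \<omega> \<noteq> 0 \<Longrightarrow> weight_vector scaleC \<pi> \<omega> (u \<omega>)"
    "w = (\<Sum>\<omega>\<in>S. u \<omega>)"
proof -
  obtain S u where S: "finite S" and exp: "\<And>x. \<forall>i. x $ i \<noteq> 0 \<Longrightarrow>
      \<pi> (diag_matrix x) w = (\<Sum>\<omega>\<in>S. scaleC (character \<omega> x) (u \<omega>))"
    using rep_torus_laurent[of w] unfolding laurent_def by blast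
  have "\<pi> (diag_matrix y) (u \<omega>) = scaleC (character \<omega> y) (u \<omega>)"
    if y: "\<forall>i. y $ i \<noteq> 0" and \<omega>: "\<omega> \<in> S" for y \<omega>
  proof -
    have "\<pi> (diag_matrix y) (u \<omega>) - scaleC (character \<omega> y) (u \<omega>) = 0"
    proof (rule characters_independent[OF S _ \<omega>])
      fix x :: "complex^'n" assume x: "\<forall>i. x $ i \<noteq> 0"
      have "\<pi> (diag_matrix y) (\<pi> (diag_matrix x) w) = \<pi> (diag_matrix (x * y)) w"
        using x y by (subst rep_mult[symmetric])
          (simp_all add: invertible_diag_matrix diag_matrix_mult mult.commute)
      then have "(\<Sum>\<omega>\<in>S. scaleC (character \<omega> x) (\<pi> (diag_matrix y) (u \<omega>)))
          = (\<Sum>\<omega>\<in>S. scaleC (character \<omega> x) (scaleC (character \<omega> y) (u \<omega>)))"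
        using x y by (simp add: exp rep_sum rep_scale invertible_diag_matrix character_mult)
      then show "(\<Sum>\<omega>\<in>S. scaleC (character \<omega> x)
          (\<pi> (diag_matrix y) (u \<omega>) - scaleC (character \<omega> y) (u \<omega>))) = 0"
        by (simp only: scale_right_diff_distrib sum_subtractf diff_self)
    qed
    then show ?thesis by simp
  qed
  then have "\<omega> \<in> S \<Longrightarrow> u \<omega> \<noteq> 0 \<Longrightarrow> weight_vector scaleC \<pi> \<omega> (u \<omega>)" for \<omega>
    by (simp add: weight_vector_def character_def)
  moreover have "w = (\<Sum>\<omega>\<in>S. u \<omega>)"
    using exp[of 1] by (simp add: rep_one)
  ultimately show ?thesis using that S by blast
qed

abbreviation "\<Omega> \<equiv> weights scaleC \<pi>"

lemma weight_vectorD: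
  "weight_vector scaleC \<pi> \<omega> w \<Longrightarrow> \<forall>i. x $ i \<noteq> 0 \<Longrightarrow>
     \<pi> (diag_matrix x) w = scaleC (character \<omega> x) w"
  by (simp add: weight_vector_def character_def)

text \<open>
  By independence of characters, only the exponents in the Laurent expansions of the orbit maps of
  the finitely many basis vectors can be weights.
\<close>

lemma finite_weights: "finite \<Omega>"
proof -
  have "\<forall>b. \<exists>S u. finite S \<and> (\<forall>x. (\<forall>i. x $ i \<noteq> 0) \<longrightarrow>
      \<pi> (diag_matrix x) b = (\<Sum>\<omega>\<in>S. scaleC (character \<omega> x) (u \<omega>)))"
    using rep_torus_laurent unfolding laurent_def by blast
  then obtain S u where S: "\<And>b. finite (S b)" and u: "\<And>b x. \<forall>i. x $ i \<noteq> 0 \<Longrightarrow>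
      \<pi> (diag_matrix x) b = (\<Sum>\<omega>\<in>S b. scaleC (character \<omega> x) (u b \<omega>))"
    by metis
  define T where "T = (\<Union>b\<in>Basis. S b)"
  have T: "finite T" using S finite_Basis by (simp add: T_def)
  have "\<Omega> \<subseteq> T"
  proof
    fix \<nu> assume "\<nu> \<in> \<Omega>"
    then obtain w where w: "weight_vector scaleC \<pi> \<nu> w" by (auto simp: weights_def)
    show "\<nu> \<in> T"
    proof (rule ccontr)
      assume \<nu>: "\<nu> \<notin> T"
      define a where "a b = representation Basis w b" for b
      have wa: "(\<Sum>b\<in>Basis. scaleC (a b) b) = w" unfolding a_def
        using independent_Basis span_Basis finite_Basis by (intro sum_representation_eq) auto
      \<comment> \<open>A relation between the characters in \<open>insert \<nu> T\<close> whose coefficient at \<open>\<nu>\<close> is \<open>- w\<close>.\<close>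
      define z where "z \<omega> = (if \<omega> = \<nu> then - w
         else (\<Sum>b\<in>Basis. if \<omega> \<in> S b then scaleC (a b) (u b \<omega>) else 0))" for \<omega>
      have "z \<nu> = 0"
      proof (rule characters_independent[of "insert \<nu> T"])
        fix x :: "complex^'n" assume x: "\<forall>i. x $ i \<noteq> 0"
        have "scaleC (character \<nu> x) w = \<pi> (diag_matrix x) (\<Sum>b\<in>Basis. scaleC (a b) b)"
          by (simp add: wa weight_vectorD[OF w x])
        also have "\<dots> = (\<Sum>b\<in>Basis. \<Sum>\<omega>\<in>S b. scaleC (character \<omega> x) (scaleC (a b) (u b \<omega>)))"
          by (simp add: rep_sum rep_scale invertible_diag_matrix x u scale_sum_right mult.commute)
        also have "\<dots> = (\<Sum>b\<in>Basis. \<Sum>\<omega>\<in>T. scaleC (character \<omega> x)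
            (if \<omega> \<in> S b then scaleC (a b) (u b \<omega>) else 0))"
          by (intro sum.cong refl sum.mono_neutral_cong_left T) (auto simp: T_def)
        also have "\<dots> = (\<Sum>\<omega>\<in>T. \<Sum>b\<in>Basis. scaleC (character \<omega> x)
            (if \<omega> \<in> S b then scaleC (a b) (u b \<omega>) else 0))"
          by (rule sum.swap)
        also have "\<dots> = (\<Sum>\<omega>\<in>T. scaleC (character \<omega> x) (z \<omega>))"
          unfolding scale_sum_right[symmetric] using \<nu> by (intro sum.cong) (auto simp: z_def)
        finally show "(\<Sum>\<omega>\<in>insert \<nu> T. scaleC (character \<omega> x) (z \<omega>)) = 0"
          using \<nu> T by (simp add: z_def)
      qed (use T in auto)
      then show False using w by (simp add: z_def weight_vector_def)
    qed
  qed
  then show ?thesis using T by (rule finite_subset)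
qed

lemma ex_components:
  "\<exists>u. (\<forall>\<omega>. u \<omega> \<noteq> 0 \<longrightarrow> weight_vector scaleC \<pi> \<omega> (u \<omega>)) \<and> w = (\<Sum>\<omega>\<in>\<Omega>. u \<omega>)"
proof -
  obtain S u where S: "finite S"
    and u: "\<And>\<omega>. \<omega> \<in> S \<Longrightarrow> u \<omega> \<noteq> 0 \<Longrightarrow> weight_vector scaleC \<pi> \<omega> (u \<omega>)" and w: "w = (\<Sum>\<omega>\<in>S. u \<omega>)"
    by (rule torus_expansion[of w]) blast
  have "w = (\<Sum>\<omega>\<in>\<Omega>. if \<omega> \<in> S then u \<omega> else 0)"
    unfolding w using u S finite_weights
    by (intro sum.mono_neutral_cong) (auto simp: weights_def)
  then show ?thesis using u by (intro exI[of _ "\<lambda>\<omega>. if \<omega> \<in> S then u \<omega> else 0"]) auto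
qed

text \<open>
  The component of \<open>w\<close> of weight \<open>\<omega>\<close>. All weights share one choice of a decomposition of \<open>w\<close>, so that
  the components sum to \<open>w\<close>.
\<close>

definition component :: "int^'n \<Rightarrow> 'v \<Rightarrow> 'v" where
  "component \<omega> w = (SOME u. (\<forall>\<omega>. u \<omega> \<noteq> 0 \<longrightarrow> weight_vector scaleC \<pi> \<omega> (u \<omega>)) \<and>
     w = (\<Sum>\<omega>\<in>\<Omega>. u \<omega>)) \<omega>"

lemma component_weight_vector:
    "component \<omega> w \<noteq> 0 \<Longrightarrow> weight_vector scaleC \<pi> \<omega> (component \<omega> w)"
  and component_sum: "(\<Sum>\<omega>\<in>\<Omega>. component \<omega> w) = w"
  using someI_ex[OF ex_components[of w]] by (simp_all add: component_def)

lemma torus_component: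
  assumes "\<forall>i. x $ i \<noteq> 0"
  shows "\<pi> (diag_matrix x) (component \<omega> w) = scaleC (character \<omega> x) (component \<omega> w)"
proof (cases "component \<omega> w = 0")
  case True
  then show ?thesis using assms by (simp add: invertible_diag_matrix)
next
  case False
  then show ?thesis using weight_vectorD[OF component_weight_vector] assms by blast
qed

lemma torus_action:
  assumes "\<forall>i. x $ i \<noteq> 0"
  shows "\<pi> (diag_matrix x) w = (\<Sum>\<omega>\<in>\<Omega>. scaleC (character \<omega> x) (component \<omega> w))"
  by (subst component_sum[of w, symmetric])
     (simp add: rep_sum assms invertible_diag_matrix torus_component)

end

section \<open>Invariant inner products\<close>

context hermitian_inner_product
begin

sublocale complex_vector_space scaleC ..

abbreviation nrm :: "'v \<Rightarrow> real" where "nrm \<equiv> ip_norm ip"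

lemma ip_add_left: "ip (x + y) z = ip x z + ip y z"
  by (subst (1 2 3) ip_commute) (simp add: ip_add_right)

lemma ip_scale_left: "ip (scaleC c x) y = cnj c * ip x y"
  by (subst (1 2) ip_commute) (simp add: ip_scale_right)

lemma ip_zero_right [simp]: "ip x 0 = 0"
  using ip_scale_right[of x 0 0] by simp

lemma ip_zero_left [simp]: "ip 0 x = 0"
  using ip_scale_left[of 0 0 x] by simp

lemma ip_diff_right: "ip x (y - z) = ip x y - ip x z"
  using ip_add_right[of x "y - z" z] by simp

lemma ip_sum_right: "ip x (\<Sum>i\<in>I. f i) = (\<Sum>i\<in>I. ip x (f i))"
  by (induction I rule: infinite_finite_induct) (auto simp: ip_add_right)

lemma ip_sum_left: "ip (\<Sum>i\<in>I. f i) x = (\<Sum>i\<in>I. ip (f i) x)"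
  by (induction I rule: infinite_finite_induct) (auto simp: ip_add_left)

lemma Re_ip_self_nonneg: "0 \<le> Re (ip x x)"
  using ip_pos[of x] by (cases "x = 0") auto

lemma nrm_square: "(nrm x)\<^sup>2 = Re (ip x x)"
  by (simp add: ip_norm_def Re_ip_self_nonneg)

lemma ip_self: "ip x x = complex_of_real ((nrm x)\<^sup>2)"
  using ip_commute[of x x] by (simp add: nrm_square complex_eq_iff)

lemma nrm_nonneg: "0 \<le> nrm x"
  by (simp add: ip_norm_def Re_ip_self_nonneg)

lemma nrm_zero [simp]: "nrm 0 = 0"
  by (simp add: ip_norm_def)

lemma nrm_pos: "x \<noteq> 0 \<Longrightarrow> 0 < nrm x"
  using ip_pos by (simp add: ip_norm_def)

lemma nrm_scale: "(nrm (scaleC c x))\<^sup>2 = (cmod c)\<^sup>2 * (nrm x)\<^sup>2"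
proof -
  have "ip (scaleC c x) (scaleC c x) = c * cnj c * ip x x"
    unfolding ip_scale_left ip_scale_right by (simp add: mult_ac)
  also have "\<dots> = complex_of_real ((cmod c)\<^sup>2 * (nrm x)\<^sup>2)"
    unfolding ip_self complex_norm_square[symmetric] by simp
  finally have "ip (scaleC c x) (scaleC c x) = complex_of_real ((cmod c)\<^sup>2 * (nrm x)\<^sup>2)" .
  then show ?thesis unfolding ip_self of_real_eq_iff .
qed

lemma nrm_orthogonal_sum:
  assumes "\<And>i j. i \<in> I \<Longrightarrow> j \<in> I \<Longrightarrow> i \<noteq> j \<Longrightarrow> ip (f i) (f j) = 0" and "finite I"
  shows "(nrm (\<Sum>i\<in>I. f i))\<^sup>2 = (\<Sum>i\<in>I. (nrm (f i))\<^sup>2)"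
proof -
  have "ip (\<Sum>i\<in>I. f i) (\<Sum>i\<in>I. f i) = (\<Sum>i\<in>I. \<Sum>j\<in>I. ip (f i) (f j))"
    unfolding ip_sum_left unfolding ip_sum_right ..
  also have "\<dots> = (\<Sum>i\<in>I. \<Sum>j\<in>I. if j = i then ip (f i) (f i) else 0)"
    using assms(1) by (intro sum.cong) auto
  also have "\<dots> = (\<Sum>i\<in>I. ip (f i) (f i))" using assms(2) by simp
  finally show ?thesis unfolding nrm_square by simp
qed

text \<open>
  Gram-Schmidt: the step from \<open>B\<close> to \<open>insert b B\<close> corrects the projection onto \<open>span B\<close> by a
  multiple of the part of \<open>b\<close> that is orthogonal to \<open>span B\<close>.
\<close>

lemma orthogonal_projection_span:
  assumes "finite B"
  shows "\<exists>p\<in>span B. \<forall>s\<in>span B. ip s (w - p) = 0"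
  using assms
proof (induction B arbitrary: w rule: finite_induct)
  case empty
  show ?case by simp
next
  case (insert b B)
  obtain b0 where b0: "b0 \<in> span B" "\<And>s. s \<in> span B \<Longrightarrow> ip s (b - b0) = 0"
    using insert.IH[of b] by blast
  obtain w0 where w0: "w0 \<in> span B" "\<And>s. s \<in> span B \<Longrightarrow> ip s (w - w0) = 0"
    using insert.IH[of w] by blast
  define e where "e = b - b0"
  \<comment> \<open>For \<open>e = 0\<close> the quotient is \<open>0\<close>, which is the correct coefficient in that case.\<close>
  define c where "c = ip e w / ip e e"
  have sub: "span B \<subseteq> span (insert b B)" by (rule span_mono) auto
  have e: "e \<in> span (insert b B)"
    unfolding e_def by (rule span_diff[OF span_base subsetD[OF sub b0(1)]]) simp
  have eB: "ip s e = 0" "ip e s = 0" if "s \<in> span B" for s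
    using b0(2)[OF that] ip_commute[of e s] by (auto simp: e_def)
  have ce: "c * ip e e = ip e w"
    using ip_pos[of e] by (cases "e = 0") (auto simp: c_def)
  show ?case
  proof (intro bexI ballI)
    show "w0 + scaleC c e \<in> span (insert b B)"
      using w0(1) sub e by (intro span_add span_scale) auto
    fix s assume "s \<in> span (insert b B)"
    then obtain k where k: "s - scaleC k b \<in> span B" by (auto simp: span_insert)
    define r where "r = s - scaleC k e"
    have "r = (s - scaleC k b) + scaleC k b0" by (simp add: r_def e_def scale_right_diff_distrib)
    then have r: "r \<in> span B" using k b0(1) by (simp add: span_add span_scale)
    have s: "s = r + scaleC k e" by (simp add: r_def)
    have "ip r (w - (w0 + scaleC c e)) = 0"
      using w0(2)[OF r] eB(1)[OF r] by (simp add: ip_diff_right ip_add_right ip_scale_right)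
    moreover have "ip e (w - (w0 + scaleC c e)) = 0"
      using eB(2)[OF w0(1)] ce by (simp add: ip_diff_right ip_add_right ip_scale_right)
    ultimately show "ip s (w - (w0 + scaleC c e)) = 0"
      by (simp add: s ip_add_left ip_scale_left)
  qed
qed

end

locale unitary_representation =
  rational_representation scaleC Basis \<pi> + hermitian_inner_product scaleC ip
  for scaleC :: "complex \<Rightarrow> 'v::ab_group_add \<Rightarrow> 'v" and Basis :: "'v set"
    and \<pi> :: "complex^'n^'n \<Rightarrow> 'v \<Rightarrow> 'v" and ip :: "'v \<Rightarrow> 'v \<Rightarrow> complex" +
  assumes invariant: "unitary_invariant ip \<pi>"
begin

lemma ip_unitary: "unitary_matrix u \<Longrightarrow> ip (\<pi> u x) (\<pi> u y) = ip x y"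
  using invariant by (simp add: unitary_invariant_def)

lemma nrm_unitary: "unitary_matrix u \<Longrightarrow> nrm (\<pi> u x) = nrm x"
  by (simp add: ip_norm_def ip_unitary)

lemma rep_inverse_cancel:
  "invertible g \<Longrightarrow> invertible h \<Longrightarrow> h ** g = mat 1 \<Longrightarrow> \<pi> h (\<pi> g w) = w"
  by (metis rep_mult rep_one)

lemma rep_nonzero: assumes "invertible g" "w \<noteq> 0" shows "\<pi> g w \<noteq> 0"
proof
  assume 0: "\<pi> g w = 0"
  obtain h where h: "h ** g = mat 1" "g ** h = mat 1"
    using assms(1) by (auto simp: invertible_def)
  then have "invertible h" by (auto simp: invertible_def)
  then have "\<pi> h (\<pi> g w) = w" using h assms by (intro rep_inverse_cancel)
  with 0 \<open>invertible h\<close> assms show False by simp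
qed

lemma components_orthogonal:
  assumes "\<omega> \<noteq> \<nu>" shows "ip (component \<omega> x) (component \<nu> y) = 0"
proof -
  obtain t where t: "\<forall>i. cmod (t $ i) = 1" and sep: "character \<omega> t \<noteq> character \<nu> t"
    using characters_separated[OF assms] by blast
  have t0: "\<forall>i. t $ i \<noteq> 0" using t by (metis norm_zero zero_neq_one)
  have "cnj z * z = 1" if "cmod z = 1" for z
    using that complex_norm_square[of z] by (simp add: mult.commute)
  then have "(\<chi> i. cnj (t $ i)) * t = 1" using t by (simp add: vec_eq_iff)
  then have u: "unitary_matrix (diag_matrix t)"
    by (intro unitaryI) (simp add: diag_matrix_mult)
  have one: "cnj (character \<omega> t) * character \<omega> t = 1"
  proof -
    have "cmod (character \<omega> t) = 1"
      using t by (simp add: character_def prod_norm[symmetric] norm_power_int)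
    then show ?thesis using complex_norm_square[of "character \<omega> t"] by (simp add: mult.commute)
  qed
  have "ip (component \<omega> x) (component \<nu> y)
      = cnj (character \<omega> t) * character \<nu> t * ip (component \<omega> x) (component \<nu> y)"
    using ip_unitary[OF u, of "component \<omega> x" "component \<nu> y"]
    by (simp add: torus_component t0 ip_scale_left ip_scale_right mult_ac)
  moreover have "cnj (character \<omega> t) * character \<nu> t \<noteq> 1"
  proof
    assume "cnj (character \<omega> t) * character \<nu> t = 1"
    then have "cnj (character \<omega> t) * character \<nu> t = cnj (character \<omega> t) * character \<omega> t"
      by (simp only: one)
    moreover have "cnj (character \<omega> t) \<noteq> 0" using one by auto
    ultimately have "character \<nu> t = character \<omega> t" by simp
    with sep show False by simp
  qed
  ultimately show ?thesis by (metis mult_cancel_right1)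
qed

lemma exp_diag_action:
  "\<pi> (exp_diag h) w
    = (\<Sum>\<omega>\<in>\<Omega>. scaleC (complex_of_real (exp (inner h (real_weight \<omega>)))) (component \<omega> w))"
  unfolding exp_diag_def by (subst torus_action) (simp_all add: character_exp)

lemma nrm_exp_diag:
  "(nrm (\<pi> (exp_diag h) w))\<^sup>2
    = (\<Sum>\<omega>\<in>\<Omega>. (nrm (component \<omega> w))\<^sup>2 * exp (inner (2 *\<^sub>R h) (real_weight \<omega>)))"
proof -
  have "(nrm (\<pi> (exp_diag h) w))\<^sup>2 = (\<Sum>\<omega>\<in>\<Omega>. (nrm (scaleC
      (complex_of_real (exp (inner h (real_weight \<omega>)))) (component \<omega> w)))\<^sup>2)"
    unfolding exp_diag_action
    by (rule nrm_orthogonal_sum)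
       (simp_all add: finite_weights ip_scale_left ip_scale_right components_orthogonal)
  also have "\<dots> = (\<Sum>\<omega>\<in>\<Omega>. (nrm (component \<omega> w))\<^sup>2 * exp (inner (2 *\<^sub>R h) (real_weight \<omega>)))"
    by (simp add: nrm_scale exp_double mult.commute)
  finally show ?thesis .
qed

lemma nrm_components: "(nrm w)\<^sup>2 = (\<Sum>\<omega>\<in>\<Omega>. (nrm (component \<omega> w))\<^sup>2)"
  using nrm_exp_diag[of 0 w] by (simp add: rep_one)

lemma ip_component:
  assumes "\<omega> \<in> \<Omega>"
  shows "ip (component \<omega> x) y = ip (component \<omega> x) (component \<omega> y)"
    and "ip x (component \<omega> y) = ip (component \<omega> x) (component \<omega> y)"
proof -
  have "ip (component \<omega> x) y = (\<Sum>\<nu>\<in>\<Omega>. ip (component \<omega> x) (component \<nu> y))"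
    by (subst component_sum[of y, symmetric]) (rule ip_sum_right)
  also have "\<dots> = (\<Sum>\<nu>\<in>\<Omega>. if \<nu> = \<omega> then ip (component \<omega> x) (component \<omega> y) else 0)"
    by (intro sum.cong) (auto simp: components_orthogonal)
  finally show "ip (component \<omega> x) y = ip (component \<omega> x) (component \<omega> y)"
    using assms finite_weights by simp
  have "ip x (component \<omega> y) = (\<Sum>\<nu>\<in>\<Omega>. ip (component \<nu> x) (component \<omega> y))"
    by (subst component_sum[of x, symmetric]) (rule ip_sum_left)
  also have "\<dots> = (\<Sum>\<nu>\<in>\<Omega>. if \<nu> = \<omega> then ip (component \<omega> x) (component \<omega> y) else 0)"
    by (intro sum.cong) (auto simp: components_orthogonal)
  finally show "ip x (component \<omega> y) = ip (component \<omega> x) (component \<omega> y)"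
    using assms finite_weights by simp
qed

lemma exp_diag_self_adjoint: "ip (\<pi> (exp_diag h) x) y = ip x (\<pi> (exp_diag h) y)"
  unfolding exp_diag_action ip_sum_left ip_sum_right ip_scale_left ip_scale_right
  by (intro sum.cong refl) (simp add: trans[OF ip_component(1) ip_component(2)[symmetric]])

lemma ip_unitary_adjoint:
  assumes u: "unitary_matrix u"
  shows "ip (\<pi> u x) y = ip x (\<pi> (conj_transpose u) y)"
proof -
  have "\<pi> u (\<pi> (conj_transpose u) y) = y"
    using u by (intro rep_inverse_cancel unitary_invertible unitary_conj_transpose)
      (auto simp: unitary_matrix_def)
  then show ?thesis using ip_unitary[OF u, of x "\<pi> (conj_transpose u) y"] by simp
qed

text \<open>
  Unitary matrices act by unitary maps, and \<open>exp(h)\<close> acts by real scalars on orthogonal weight spaces,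
  hence by a self-adjoint map. The decomposition \<open>g = K exp(h) L\<close> combines the two.
\<close>

lemma rep_adjoint:
  assumes "invertible g"
  shows "ip (\<pi> g x) y = ip x (\<pi> (conj_transpose g) y)"
proof -
  obtain K h L where K: "unitary_matrix K" and L: "unitary_matrix L"
    and g: "g = K ** exp_diag h ** L" using assms by (rule KAK_decomposition)
  note inv = unitary_invertible[OF K] unitary_invertible[OF L]
    unitary_invertible[OF unitary_conj_transpose[OF K]]
    unitary_invertible[OF unitary_conj_transpose[OF L]] invertible_exp_diag invertible_mult
  have "ip (\<pi> g x) y = ip (\<pi> K (\<pi> (exp_diag h) (\<pi> L x))) y"
    by (simp add: g rep_mult inv)
  also have "\<dots> = ip x (\<pi> (conj_transpose L) (\<pi> (exp_diag h) (\<pi> (conj_transpose K) y)))"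
    by (simp add: ip_unitary_adjoint K L exp_diag_self_adjoint)
  also have "\<dots> = ip x (\<pi> (conj_transpose g) y)"
    by (simp add: g conj_transpose_mult rep_mult inv)
  finally show ?thesis .
qed

lemma orthogonal_projection:
  assumes "subspace W"
  obtains p where "p \<in> W" "\<And>s. s \<in> W \<Longrightarrow> ip s (w - p) = 0"
proof -
  obtain B where B: "B \<subseteq> W" "independent B" "W \<subseteq> span B" by (rule basis_exists[of W])
  have "span B = W" using B assms by (simp add: span_subspace)
  moreover have "finite B" using B(2) by (rule finiteI_independent)
  ultimately show ?thesis using orthogonal_projection_span[of B w] that by blast
qed

abbreviation "subrep \<equiv> subrepresentation scaleC \<pi>"

lemma subrepD: "subrep W \<Longrightarrow> invertible g \<Longrightarrow> x \<in> W \<Longrightarrow> \<pi> g x \<in> W"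
  and subrep_subspace: "subrep W \<Longrightarrow> subspace W"
  by (auto simp: subrepresentation_def)

definition ortho :: "'v set \<Rightarrow> 'v set" where "ortho U = {x. \<forall>y\<in>U. ip y x = 0}"

lemma subrep_ortho: assumes "subrep U" shows "subrep (ortho U)"
  unfolding subrepresentation_def
proof (intro conjI allI impI subsetI)
  show "subspace (ortho U)"
    by (auto simp: subspace_def ortho_def ip_add_right ip_scale_right)
  fix g :: "complex^'n^'n" and z
  assume g: "invertible g" and "z \<in> \<pi> g ` ortho U"
  then obtain x where x: "x \<in> ortho U" and z: "z = \<pi> g x" by blast
  have "ip y z = 0" if "y \<in> U" for y
  proof -
    have "ip y z = cnj (ip x (\<pi> (conj_transpose g) y))"
      by (subst ip_commute) (simp add: z rep_adjoint[OF g])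
    also have "\<dots> = ip (\<pi> (conj_transpose g) y) x"
      by (rule ip_commute[symmetric])
    also have "\<dots> = 0"
      using x that subrepD[OF assms invertible_conj_transpose[OF g]] by (simp add: ortho_def)
    finally show ?thesis .
  qed
  then show "z \<in> ortho U" by (simp add: ortho_def)
qed

lemma subrep_Int: "subrep U \<Longrightarrow> subrep W \<Longrightarrow> subrep (U \<inter> W)"
  by (auto simp: subrepresentation_def subspace_inter image_subset_iff)

lemma ortho_disjoint: "x \<in> U \<Longrightarrow> x \<in> ortho U \<Longrightarrow> x = 0"
  using ip_pos[of x] by (auto simp: ortho_def)

text \<open>
  The defect \<open>\<pi>(g) p - c p\<close> lies in \<open>U\<close> and is the negative of the corresponding defect of \<open>q\<close>, which
  lies in the orthogonal complement of \<open>U\<close>.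
\<close>

lemma eigenvector_split:
  assumes U: "subrep U" and p: "p \<in> U" and q: "q \<in> ortho U" and g: "invertible g"
    and eig: "\<pi> g (p + q) = scaleC c (p + q)"
  shows "\<pi> g p = scaleC c p" "\<pi> g q = scaleC c q"
proof -
  define d where "d = \<pi> g p - scaleC c p"
  have d': "d = scaleC c q - \<pi> g q"
    using eig g by (simp add: d_def rep_add scale_right_distrib algebra_simps)
  have "d \<in> U" unfolding d_def
    using subrepD[OF U g p] subrep_subspace[OF U] p by (intro subspace_diff subspace_scale) auto
  moreover have "d \<in> ortho U" unfolding d'
    using subrepD[OF subrep_ortho[OF U] g q] subrep_subspace[OF subrep_ortho[OF U]] q
    by (intro subspace_diff subspace_scale) auto
  ultimately have "d = 0" by (rule ortho_disjoint)
  then show "\<pi> g p = scaleC c p" "\<pi> g q = scaleC c q" using d' by (auto simp: d_def)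
qed

text \<open>
  Among the subrepresentations containing a nonzero vector with the prescribed eigenvalues, take one
  of least dimension. A proper nonzero subrepresentation of it and its orthogonal complement would
  split that vector into two vectors with the same eigenvalues, one of them nonzero, in smaller
  subrepresentations.
\<close>

lemma ex_irreducible_with_eigenvector:
  assumes z: "z \<noteq> 0" and eig: "\<And>g c. (g, c) \<in> E \<Longrightarrow> invertible g \<and> \<pi> g z = scaleC c z"
  obtains W w where "irreducible_subrepresentation scaleC \<pi> W" "w \<in> W" "w \<noteq> 0"
    "\<And>g c. (g, c) \<in> E \<Longrightarrow> \<pi> g w = scaleC c w"
proof -
  define P where "P W \<longleftrightarrow> subrep W \<and>
    (\<exists>w\<in>W. w \<noteq> 0 \<and> (\<forall>(g, c)\<in>E. \<pi> g w = scaleC c w))" for W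
  have "subrep UNIV" by (auto simp: subrepresentation_def)
  then have "P UNIV" unfolding P_def using z eig by blast
  then obtain W where W: "P W" and min: "\<And>U. P U \<Longrightarrow> dim W \<le> dim U"
    using ex_has_least_nat[of P UNIV dim] by blast
  obtain w where w: "w \<in> W" "w \<noteq> 0" "\<And>g c. (g, c) \<in> E \<Longrightarrow> \<pi> g w = scaleC c w"
    using W by (auto simp: P_def)
  have sW: "subrep W" using W by (simp add: P_def)
  have minimal: "U = W" if "P U" "U \<subseteq> W" for U
    using that min[OF that(1)] subrep_subspace[OF sW] subrep_subspace[of U]
    by (intro subspace_dim_equal) (auto simp: P_def)
  have "irreducible_subrepresentation scaleC \<pi> W"
    unfolding irreducible_subrepresentation_def
  proof (intro conjI allI impI sW)
    show "W \<noteq> {0}" using w by blast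
    fix U assume "subrep U \<and> U \<subseteq> W"
    then have U: "subrep U" "U \<subseteq> W" by auto
    obtain p where p: "p \<in> U" "\<And>s. s \<in> U \<Longrightarrow> ip s (w - p) = 0"
      using orthogonal_projection[OF subrep_subspace[OF U(1)], of w] by blast
    define q where "q = w - p"
    have q: "q \<in> ortho U" using p by (simp add: q_def ortho_def)
    have pq: "w = p + q" by (simp add: q_def)
    have qW: "q \<in> W" unfolding q_def using subrep_subspace[OF sW] w p U
      by (intro subspace_diff) auto
    have split: "\<pi> g p = scaleC c p" "\<pi> g q = scaleC c q" if "(g, c) \<in> E" for g c
      using eigenvector_split[OF U(1) p(1) q, of g c] w(3)[OF that] eig[OF that] pq by auto
    show "U = {0} \<or> U = W"
    proof (cases "p = 0")
      case False
      then have "P U" using U(1) p(1) split by (auto simp: P_def)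
      then show ?thesis using minimal U(2) by blast
    next
      case True
      then have "q \<noteq> 0" using w pq by simp
      then have "P (W \<inter> ortho U)"
        using subrep_Int[OF sW subrep_ortho[OF U(1)]] qW q split by (auto simp: P_def)
      then have "W \<inter> ortho U = W" by (intro minimal) auto
      then have "x = 0" if "x \<in> U" for x using that U(2) ortho_disjoint[of x U] by blast
      then show ?thesis using subspace_0[OF subrep_subspace[OF U(1)]] by blast
    qed
  qed
  then show ?thesis using that w by blast
qed

end

section \<open>Regular functions are differentiable\<close>

lemma bounded_linear_differentiable:
  "bounded_linear L \<Longrightarrow> f differentiable F \<Longrightarrow> (\<lambda>x. L (f x)) differentiable F"
  unfolding differentiable_def using bounded_linear.has_derivative by blast

lemma differentiable_product:
  fixes f :: "'i \<Rightarrow> 'a::real_normed_vector \<Rightarrow> 'b::real_normed_field"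
  assumes "\<And>i. i \<in> I \<Longrightarrow> (f i) differentiable (at x within S)"
  shows "(\<lambda>x. \<Prod>i\<in>I. f i x) differentiable (at x within S)"
  using assms by (induction I rule: infinite_finite_induct) auto

lemma matrix_entry_differentiable:
  "(\<lambda>g :: complex^'n^'m. g $ i $ j) differentiable F"
proof -
  have "bounded_linear (\<lambda>g :: complex^'n^'m. g $ i $ j)"
    using bounded_linear_compose[OF bounded_linear_vec_nth bounded_linear_vec_nth] .
  then show ?thesis by (rule bounded_linear_imp_differentiable)
qed

lemma det_differentiable: "det differentiable (at (g :: complex^'n^'n) within S)"
  unfolding det_def[abs_def]
  by (intro differentiable_sum ballI differentiable_mult differentiable_product
      matrix_entry_differentiable differentiable_const) simp

text \<open>
  Differentiability at the identity makes the derivative in the definition of the moment map linear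
  in the direction. Its consequence, continuity, is what the contraction of unitriangular matrices
  uses.
\<close>

lemma regular_function_differentiable:
  assumes "regular_function p" "invertible g"
  shows "p differentiable (at g)"
  using assms
proof induction
  case inverse_det
  then show ?case
    by (intro differentiable_inverse det_differentiable) (simp add: invertible_det_nz)
qed (auto intro: matrix_entry_differentiable)

context unitary_representation
begin

lemma nrm_square_differentiable:
  assumes g: "invertible g"
  shows "(\<lambda>g. (nrm (\<pi> g w - z))\<^sup>2) differentiable (at g)"
proof -
  obtain p where p: "\<And>c. c \<in> Basis \<Longrightarrow> regular_function (p c)"
    "\<And>g. invertible g \<Longrightarrow> \<pi> g w = (\<Sum>c\<in>Basis. scaleC (p c g) c)"
    by (rule rep_regular_coordinates[of w]) blast
  define q where "q c g = p c g - representation Basis z c" for c g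
  have z: "(\<Sum>b\<in>Basis. scaleC (representation Basis z b) b) = z"
    using independent_Basis span_Basis finite_Basis by (intro sum_representation_eq) auto
  have q: "q c differentiable (at g)" if "c \<in> Basis" for c
    unfolding q_def using regular_function_differentiable[OF p(1)[OF that] g] by simp
  define F where "F g = Re (\<Sum>b\<in>Basis. \<Sum>c\<in>Basis. cnj (q b g) * q c g * ip b c)" for g
  have F: "F differentiable (at g)"
    unfolding F_def
    by (intro bounded_linear_differentiable[OF bounded_linear_Re] differentiable_sum ballI finite_Basis
        differentiable_mult bounded_linear_differentiable[OF bounded_linear_cnj] q
        differentiable_const)
  have eq: "F g = (nrm (\<pi> g w - z))\<^sup>2" if "invertible g" for g
  proof -
    have "\<pi> g w - z = (\<Sum>c\<in>Basis. scaleC (q c g) c)"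
      by (subst z[symmetric]) (simp add: p(2)[OF that] q_def scale_left_diff_distrib sum_subtractf)
    then have "ip (\<pi> g w - z) (\<pi> g w - z)
        = (\<Sum>b\<in>Basis. \<Sum>c\<in>Basis. ip (scaleC (q b g) b) (scaleC (q c g) c))"
      unfolding ip_sum_left[symmetric] ip_sum_right[symmetric] by simp
    then show ?thesis
      unfolding nrm_square F_def by (simp only: ip_scale_left ip_scale_right mult_ac)
  qed
  have "open {g :: complex^'n^'n. det g \<noteq> 0}"
    by (intro open_Collect_neq differentiable_imp_continuous_on)
       (auto simp: differentiable_on_def det_differentiable)
  then have ev: "eventually (\<lambda>g. F g = (nrm (\<pi> g w - z))\<^sup>2) (at g)"
    using g by (intro eventually_at_topological[THEN iffD2] exI[of _ "{g. det g \<noteq> 0}"])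
       (auto simp: invertible_det_nz intro: eq)
  obtain D where "(F has_derivative D) (at g)" using F unfolding differentiable_def by blast
  from has_derivative_transform_eventually[OF this ev eq[OF g]] show ?thesis
    unfolding differentiable_def by blast
qed

end

section \<open>Highest weights\<close>

text \<open>
  For a nonzero vector \<open>v\<close> in the kernel and the largest \<open>m\<close> with \<open>v\<^sub>m \<noteq> 0\<close>, the entry \<open>m\<close> of \<open>u v\<close> would be \<open>v\<^sub>m\<close>.
\<close>

lemma unitriangular_invertible:
  fixes u :: "complex^'n::{finite,linorder}^'n::{finite,linorder}"
  assumes u: "upper_unitriangular u"
  shows "invertible u"
  unfolding invertible_left_inverse matrix_left_invertible_ker
proof (intro allI impI)
  fix v :: "(complex, 'n) vec" assume v: "u *v v = 0"
  show "v = 0"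
  proof (rule ccontr)
    assume "v \<noteq> 0"
    define S where "S = {i. v $ i \<noteq> 0}"
    have S: "finite S" "S \<noteq> {}" using \<open>v \<noteq> 0\<close> by (auto simp: S_def vec_eq_iff)
    define m where "m = Max S"
    have m: "v $ m \<noteq> 0" using Max_in[OF S] by (simp add: m_def S_def)
    have above: "v $ j = 0" if "m < j" for j
    proof (rule ccontr)
      assume "v $ j \<noteq> 0"
      then have "j \<le> m" unfolding m_def by (intro Max_ge S) (simp add: S_def)
      with that show False by simp
    qed
    have "(u *v v) $ m = (\<Sum>j\<in>UNIV. if j = m then v $ m else 0)"
      unfolding matrix_vector_mult_def vec_lambda_beta
    proof (intro sum.cong refl)
      fix j show "u $ m $ j * v $ j = (if j = m then v $ m else 0)"
        using u above[of j] by (cases j m rule: linorder_cases) (auto simp: upper_unitriangular_def)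
    qed
    then show False using v m by simp
  qed
qed

text \<open>
  Conjugation by \<open>exp(t\<eta>)\<close> multiplies the entry at \<open>(i, j)\<close> by \<open>exp(t(\<eta>\<^sub>i - \<eta>\<^sub>j))\<close>.
\<close>

lemma unitriangular_contraction:
  fixes u :: "complex^'n::{finite,linorder}^'n::{finite,linorder}"
  assumes u: "upper_unitriangular u" and mono: "\<And>i j. i < j \<Longrightarrow> \<eta> $ i < \<eta> $ j"
  shows "((\<lambda>t. exp_diag (t *\<^sub>R \<eta>) ** u ** exp_diag (- (t *\<^sub>R \<eta>))) \<longlongrightarrow> mat 1) at_top"
proof (intro vec_tendstoI)
  fix i j
  have entry: "(exp_diag (t *\<^sub>R \<eta>) ** u ** exp_diag (- (t *\<^sub>R \<eta>))) $ i $ j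
      = complex_of_real (exp (t * (\<eta> $ i - \<eta> $ j))) * u $ i $ j" for t
    by (simp add: exp_diag_def mult_diag_entry diag_mult_entry right_diff_distrib exp_diff
        exp_minus field_simps)
  have "((\<lambda>t. complex_of_real (exp (t * (\<eta> $ i - \<eta> $ j))) * u $ i $ j) \<longlongrightarrow> mat 1 $ i $ j) at_top"
  proof (cases i j rule: linorder_cases)
    case less
    have "filterlim (\<lambda>t. (\<eta> $ i - \<eta> $ j) * t) at_bot at_top"
      by (rule filterlim_tendsto_neg_mult_at_bot[OF tendsto_const _ filterlim_ident])
         (use mono[OF less] in simp)
    then have "((\<lambda>t. exp ((\<eta> $ i - \<eta> $ j) * t)) \<longlongrightarrow> 0) at_top"
      by (rule filterlim_compose[OF exp_at_bot])
    then have "((\<lambda>t. complex_of_real (exp ((\<eta> $ i - \<eta> $ j) * t)) * u $ i $ j)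
        \<longlongrightarrow> complex_of_real 0 * u $ i $ j) at_top"
      by (intro tendsto_intros)
    then show ?thesis using less_imp_neq[OF less] by (simp add: mat_def mult.commute)
  qed (use u in \<open>auto simp: upper_unitriangular_def mat_def\<close>)
  then show "((\<lambda>t. (exp_diag (t *\<^sub>R \<eta>) ** u ** exp_diag (- (t *\<^sub>R \<eta>))) $ i $ j) \<longlongrightarrow> mat 1 $ i $ j) at_top"
    by (simp only: entry)
qed

lemma inner_lt_norm_square:
  fixes a b :: "'a::real_inner"
  assumes "norm a \<le> norm b" "a \<noteq> b"
  shows "inner a b < (norm b)\<^sup>2"
proof -
  have "0 < (norm (a - b))\<^sup>2" using assms by simp
  also have "\<dots> = (norm a)\<^sup>2 + (norm b)\<^sup>2 - 2 * inner a b"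
    by (simp add: power2_norm_eq_inner inner_diff_left inner_diff_right inner_commute)
  also have "\<dots> \<le> 2 * ((norm b)\<^sup>2 - inner a b)"
    using power_mono[OF assms(1) norm_ge_zero, of 2] by simp
  finally show ?thesis by simp
qed

lemma inj_real_weight: "inj real_weight"
  by (auto simp: inj_def real_weight_def vec_eq_iff)

text \<open>
  Upper triangularity, highest weights and \<open>spec\<close> refer to a linear order of the index set.
\<close>

locale ordered_unitary_representation = unitary_representation scaleC Basis \<pi> ip
  for scaleC :: "complex \<Rightarrow> 'v::ab_group_add \<Rightarrow> 'v" and Basis :: "'v set"
    and \<pi> :: "complex^'n::{finite,linorder}^'n::{finite,linorder} \<Rightarrow> 'v \<Rightarrow> 'v"
    and ip :: "'v \<Rightarrow> 'v \<Rightarrow> complex"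
begin

text \<open>
  Conjugating \<open>u\<close> by \<open>exp(t\<eta>)\<close> multiplies the component of weight \<open>\<nu>\<close> of \<open>z = \<pi>(u) w - w\<close> by
  \<open>exp(t \<langle>\<eta>, \<nu> - \<omega>\<rangle>)\<close>. If \<open>\<eta>\<close> has strictly increasing entries, the conjugates tend to the identity,
  so the sum of the squared norms of these components tends to \<open>0\<close>. If moreover
  \<open>\<langle>\<eta>, \<nu>\<rangle> \<ge> \<langle>\<eta>, \<omega>\<rangle>\<close> for all weights \<open>\<nu>\<close>, no factor is smaller than \<open>1\<close>, and \<open>z = 0\<close> follows. Such an
  \<open>\<eta>\<close> is a large multiple of \<open>-\<omega>\<close> with an increasing vector added: since \<open>\<omega>\<close> has maximal norm,
  \<open>\<langle>\<omega>, \<nu>\<rangle> < \<parallel>\<omega>\<parallel>\<^sup>2\<close> for every other weight \<open>\<nu>\<close>.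
\<close>

lemma maximal_weight_vector_fixed:
  assumes w: "weight_vector scaleC \<pi> \<omega> w"
    and max: "\<And>\<nu>. \<nu> \<in> \<Omega> \<Longrightarrow> norm (real_weight \<nu>) \<le> norm (real_weight \<omega>)"
    and dom: "\<And>i j. i \<le> j \<Longrightarrow> \<omega> $ j \<le> \<omega> $ i"
    and u: "upper_unitriangular u"
  shows "\<pi> u w = w"
proof -
  let ?r = "real_weight :: (int, 'n) vec \<Rightarrow> (real, 'n) vec"
  define \<iota> :: "(real, 'n) vec" where "\<iota> = (\<chi> i. real (card {j. j < i}))"
  define \<delta> where "\<delta> \<nu> = (norm (?r \<omega>))\<^sup>2 - inner (?r \<nu>) (?r \<omega>)" for \<nu>
  have \<delta>: "0 < \<delta> \<nu>" if "\<nu> \<in> \<Omega>" "\<nu> \<noteq> \<omega>" for \<nu>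
    using inner_lt_norm_square[OF max[OF that(1)]] that(2) inj_real_weight
    by (auto simp: \<delta>_def dest: injD)
  \<comment> \<open>Large enough for all weights at once; the summand of \<open>\<omega>\<close> is \<open>0\<close>.\<close>
  define K where "K = (\<Sum>\<nu>\<in>\<Omega>. \<bar>inner \<iota> (?r \<nu> - ?r \<omega>)\<bar> / \<bar>\<delta> \<nu>\<bar>)"
  have K0: "0 \<le> K" unfolding K_def by (intro sum_nonneg) auto
  define \<eta> where "\<eta> = \<iota> - K *\<^sub>R ?r \<omega>"
  have \<eta>_mono: "\<eta> $ i < \<eta> $ j" if "i < j" for i j
  proof -
    have "{k. k < i} \<subset> {k. k < j}" using that by auto
    then have "card {k. k < i} < card {k. k < j}" by (intro psubset_card_mono) auto
    moreover have "K * real_of_int (\<omega> $ j) \<le> K * real_of_int (\<omega> $ i)"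
      using K0 dom[of i j] that by (intro mult_left_mono) auto
    ultimately show ?thesis by (simp add: \<eta>_def \<iota>_def real_weight_def)
  qed
  have \<eta>_min: "inner \<eta> (?r \<omega>) \<le> inner \<eta> (?r \<nu>)" if \<nu>: "\<nu> \<in> \<Omega>" for \<nu>
  proof (cases "\<nu> = \<omega>")
    case False
    have "\<bar>inner \<iota> (?r \<nu> - ?r \<omega>)\<bar> / \<bar>\<delta> \<nu>\<bar> \<le> K"
      unfolding K_def by (rule member_le_sum) (use \<nu> finite_weights in auto)
    then have "\<bar>inner \<iota> (?r \<nu> - ?r \<omega>)\<bar> \<le> K * \<delta> \<nu>"
      using \<delta>[OF \<nu> False] by (simp add: field_simps)
    then have "0 \<le> inner \<iota> (?r \<nu> - ?r \<omega>) + K * \<delta> \<nu>" by linarith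
    also have "\<dots> = inner \<eta> (?r \<nu>) - inner \<eta> (?r \<omega>)"
      by (simp add: \<eta>_def \<delta>_def inner_diff_left inner_diff_right power2_norm_eq_inner
          inner_commute algebra_simps)
    finally show ?thesis by simp
  qed simp
  define z where "z = \<pi> u w - w"
  define g where "g t = exp_diag (t *\<^sub>R \<eta>) ** u ** exp_diag (- (t *\<^sub>R \<eta>))" for t :: real
  note inv = unitriangular_invertible[OF u] invertible_exp_diag invertible_mult
  have exp_w: "\<pi> (exp_diag h) w = scaleC (complex_of_real (exp (inner h (?r \<omega>)))) w" for h
    unfolding exp_diag_def by (subst weight_vectorD[OF w]) (simp_all add: character_exp)
  have lower: "(nrm z)\<^sup>2 \<le> (nrm (\<pi> (g t) w - w))\<^sup>2" if t: "0 \<le> t" for t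
  proof -
    let ?c = "complex_of_real (exp (- inner (t *\<^sub>R \<eta>) (?r \<omega>)))"
    have "scaleC ?c (\<pi> (exp_diag (t *\<^sub>R \<eta>)) w) = w"
      unfolding exp_w scale_scale by (simp flip: of_real_mult exp_add)
    moreover have "\<pi> (g t) w = scaleC ?c (\<pi> (exp_diag (t *\<^sub>R \<eta>)) (\<pi> u w))"
      by (simp add: g_def rep_mult inv exp_w rep_scale)
    ultimately have "\<pi> (g t) w - w = scaleC ?c (\<pi> (exp_diag (t *\<^sub>R \<eta>)) z)"
      by (simp add: z_def rep_diff inv scale_right_diff_distrib)
    then have "(nrm (\<pi> (g t) w - w))\<^sup>2 = (exp (- inner (t *\<^sub>R \<eta>) (?r \<omega>)))\<^sup>2
        * (\<Sum>\<nu>\<in>\<Omega>. (nrm (component \<nu> z))\<^sup>2 * exp (inner (2 *\<^sub>R (t *\<^sub>R \<eta>)) (?r \<nu>)))"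
      by (simp only: nrm_scale nrm_exp_diag norm_of_real abs_exp_cancel)
    also have "\<dots> = (\<Sum>\<nu>\<in>\<Omega>. (nrm (component \<nu> z))\<^sup>2
        * exp (2 * (t * (inner \<eta> (?r \<nu>) - inner \<eta> (?r \<omega>)))))"
    proof -
      have "(exp (- inner (t *\<^sub>R \<eta>) (?r \<omega>)))\<^sup>2 * exp (inner (2 *\<^sub>R (t *\<^sub>R \<eta>)) (?r \<nu>))
          = exp (2 * (t * (inner \<eta> (?r \<nu>) - inner \<eta> (?r \<omega>))))" for \<nu>
        unfolding exp_double[symmetric] exp_add[symmetric] by (simp add: algebra_simps)
      then show ?thesis unfolding sum_distrib_left by (simp only: mult.left_commute)
    qed
    also have "\<dots> \<ge> (\<Sum>\<nu>\<in>\<Omega>. (nrm (component \<nu> z))\<^sup>2 * 1)"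
    proof (intro sum_mono mult_left_mono)
      fix \<nu> assume "\<nu> \<in> \<Omega>"
      then have "0 \<le> t * (inner \<eta> (?r \<nu>) - inner \<eta> (?r \<omega>))"
        using \<eta>_min t by (intro mult_nonneg_nonneg) auto
      then show "1 \<le> exp (2 * (t * (inner \<eta> (?r \<nu>) - inner \<eta> (?r \<omega>))))" by simp
    qed simp
    finally show ?thesis unfolding nrm_components[of z] by simp
  qed
  have "isCont (\<lambda>g. (nrm (\<pi> g w - w))\<^sup>2) (mat 1)"
    by (intro differentiable_imp_continuous_within nrm_square_differentiable) (simp add: invertible_def)
  then have "((\<lambda>t. (nrm (\<pi> (g t) w - w))\<^sup>2) \<longlongrightarrow> (nrm (\<pi> (mat 1) w - w))\<^sup>2) at_top"
    unfolding g_def using unitriangular_contraction[OF u \<eta>_mono]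
    by (rule isCont_tendsto_compose)
  then have "((\<lambda>t. (nrm (\<pi> (g t) w - w))\<^sup>2) \<longlongrightarrow> 0) at_top" by (simp add: rep_one)
  then have "(nrm z)\<^sup>2 \<le> 0"
    by (rule tendsto_lowerbound)
       (use lower in \<open>auto intro: eventually_mono[OF eventually_ge_at_top[of 0]]\<close>)
  then have "z = 0" using nrm_pos[of z] by fastforce
  then show ?thesis by (simp add: z_def)
qed

text \<open>
  The matrix of \<open>\<sigma>\<close> normalizes the torus, so it carries weight vectors to weight vectors.
\<close>

lemma permuted_weight:
  assumes \<omega>: "\<omega> \<in> \<Omega>" and \<sigma>: "bij \<sigma>"
  shows "(\<chi> i. \<omega> $ \<sigma> i) \<in> \<Omega>"
proof -
  obtain w where w: "weight_vector scaleC \<pi> \<omega> w" using \<omega> by (auto simp: weights_def)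
  define P :: "((complex, 'n) vec, 'n) vec" where "P = (\<chi> i j. if j = \<sigma> i then 1 else 0)"
  have "(P ** transpose P) $ i $ j = (\<Sum>k\<in>UNIV. if k = \<sigma> i then (if i = j then 1 else 0) else 0)" for i j
    unfolding matrix_matrix_mult_def transpose_def P_def vec_lambda_beta
    using bij_is_inj[OF \<sigma>] by (intro sum.cong) (auto dest: injD)
  then have "P ** transpose P = mat 1" by (simp add: vec_eq_iff mat_def)
  then have P: "invertible P" using invertible_right_inverse by blast
  have "weight_vector scaleC \<pi> (\<chi> i. \<omega> $ \<sigma> i) (\<pi> P w)"
    unfolding weight_vector_def
  proof (intro conjI allI impI)
    show "\<pi> P w \<noteq> 0" using w P by (intro rep_nonzero) (auto simp: weight_vector_def)
    fix x :: "(complex, 'n) vec" assume x: "\<forall>i. x $ i \<noteq> 0"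
    define y :: "(complex, 'n) vec" where "y = (\<chi> j. x $ inv \<sigma> j)"
    have y: "\<forall>i. y $ i \<noteq> 0" using x by (simp add: y_def)
    have "diag_matrix x ** P = P ** diag_matrix y"
      using \<sigma> by (simp add: vec_eq_iff diag_mult_entry mult_diag_entry P_def y_def bij_is_inj)
    then have "\<pi> (diag_matrix x) (\<pi> P w) = \<pi> P (\<pi> (diag_matrix y) w)"
      by (metis rep_mult P x y invertible_diag_matrix)
    also have "\<dots> = scaleC (character \<omega> y) (\<pi> P w)"
      by (simp add: weight_vectorD[OF w y] rep_scale P)
    also have "character \<omega> y = (\<Prod>i\<in>UNIV. y $ \<sigma> i powi \<omega> $ \<sigma> i)"
      unfolding character_def by (rule prod.reindex_bij_betw[OF \<sigma>, symmetric])
    also have "\<dots> = (\<Prod>i\<in>UNIV. x $ i powi (\<chi> i. \<omega> $ \<sigma> i) $ i)"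
      using \<sigma> by (simp add: y_def bij_is_inj)
    finally show "\<pi> (diag_matrix x) (\<pi> P w)
        = scaleC (\<Prod>i\<in>UNIV. x $ i powi (\<chi> i. \<omega> $ \<sigma> i) $ i) (\<pi> P w)" .
  qed
  then show ?thesis by (auto simp: weights_def)
qed

text \<open>
  A weight of maximal norm, sorted by a permutation, is the highest weight of an irreducible
  subrepresentation, by \<open>maximal_weight_vector_fixed\<close> and \<open>ex_irreducible_with_eigenvector\<close>.
\<close>

lemma norm_weight_le_weight_norm:
  assumes "\<omega> \<in> \<Omega>"
  shows "norm (real_weight \<omega>) \<le> weight_norm scaleC \<pi>"
proof -
  let ?A = "(\<lambda>\<nu>. norm (real_weight \<nu>)) ` \<Omega>"
  have A: "finite ?A" "?A \<noteq> {}" using finite_weights assms by auto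
  obtain \<mu> where \<mu>: "\<mu> \<in> \<Omega>" "Max ?A = norm (real_weight \<mu>)" using Max_in[OF A] by auto
  have max: "norm (real_weight \<nu>) \<le> norm (real_weight \<mu>)" if "\<nu> \<in> \<Omega>" for \<nu>
    using Max_ge[OF A(1), of "norm (real_weight \<nu>)"] that \<mu>(2) by simp
  obtain \<sigma> :: "'n \<Rightarrow> 'n" where \<sigma>: "bij \<sigma>" and anti: "\<And>i j. i \<le> j \<Longrightarrow> \<mu> $ \<sigma> j \<le> \<mu> $ \<sigma> i"
    using ex_antitone_permutation[of "\<lambda>i. \<mu> $ i"] by blast
  define \<kappa> :: "(int, 'n) vec" where "\<kappa> = (\<chi> i. \<mu> $ \<sigma> i)"
  have \<kappa>: "\<kappa> \<in> \<Omega>" unfolding \<kappa>_def using \<mu>(1) \<sigma> by (rule permuted_weight)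
  have norm_eq: "norm (real_weight \<kappa>) = norm (real_weight \<mu>)"
    using sum.reindex_bij_betw[OF \<sigma>, of "\<lambda>i. (norm (real_of_int (\<mu> $ i)))\<^sup>2"]
    by (simp add: norm_vec_def L2_set_def real_weight_def \<kappa>_def)
  obtain z where z: "weight_vector scaleC \<pi> \<kappa> z" using \<kappa> by (auto simp: weights_def)
  define E where "E = {(diag_matrix x, character \<kappa> x) | x. \<forall>i. x $ i \<noteq> 0}
    \<union> {(u, 1) | u. upper_unitriangular u}"
  have "\<pi> u z = z" if "upper_unitriangular u" for u
    by (rule maximal_weight_vector_fixed[OF z _ _ that]) (simp_all add: norm_eq max, simp add: \<kappa>_def anti)
  then have eig: "invertible g \<and> \<pi> g z = scaleC c z" if "(g, c) \<in> E" for g c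
    using that weight_vectorD[OF z]
    by (auto simp: E_def invertible_diag_matrix unitriangular_invertible)
  have "z \<noteq> 0" using z by (simp add: weight_vector_def)
  then obtain W w where W: "irreducible_subrepresentation scaleC \<pi> W" "w \<in> W" "w \<noteq> 0"
    and w: "\<And>g c. (g, c) \<in> E \<Longrightarrow> \<pi> g w = scaleC c w"
    by (rule ex_irreducible_with_eigenvector[OF _ eig]) blast+
  have "\<pi> (diag_matrix x) w = scaleC (character \<kappa> x) w" if "\<forall>i. x $ i \<noteq> 0" for x
    using that by (intro w) (auto simp: E_def)
  moreover have "\<pi> u w = w" if "upper_unitriangular u" for u
    using w[of u 1] that by (auto simp: E_def)
  ultimately have "highest_weight scaleC \<pi> W \<kappa>"
    unfolding highest_weight_def weight_vector_def using W(2,3) by (auto simp: character_def)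
  then have "norm (real_weight \<kappa>) \<in> {norm (real_weight \<omega>) | \<omega>.
      \<exists>W. irreducible_subrepresentation scaleC \<pi> W \<and> highest_weight scaleC \<pi> W \<omega>}"
    using W(1) by blast
  moreover have "finite {norm (real_weight \<omega>) | \<omega>.
      \<exists>W. irreducible_subrepresentation scaleC \<pi> W \<and> highest_weight scaleC \<pi> W \<omega>}"
    by (rule finite_subset[OF _ finite_imageI[OF finite_weights, of "\<lambda>\<omega>. norm (real_weight \<omega>)"]])
       (auto simp: highest_weight_def weights_def)
  ultimately have "norm (real_weight \<kappa>) \<le> weight_norm scaleC \<pi>"
    unfolding weight_norm_def by (rule Max_ge[rotated])
  then show ?thesis using max[OF assms] norm_eq by simp
qed

end

section \<open>The moment map\<close>

lemma real_linear_functional_inner: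
  fixes D :: "'a::euclidean_space \<Rightarrow> real"
  assumes "linear D"
  obtains A where "\<And>x. D x = inner A x"
  using adjoint_works[OF assms, of _ 1] that[of "adjoint D 1"] by (simp add: inner_commute)

lemma inner_matrix:
  "inner A B = (\<Sum>i\<in>UNIV. \<Sum>j\<in>UNIV. Re (A $ i $ j * cnj (B $ i $ j)))" for A B :: "complex^'n^'m"
  by (simp add: inner_vec_def inner_complex_def)

lemma inner_conj_transpose:
  "inner (conj_transpose A) B = inner A (conj_transpose B)" for A B :: "complex^'n^'n"
  unfolding inner_matrix conj_transpose_def
  by (simp add: mult.commute) (rule sum.swap)

lemma hermitian_entry:
  assumes "hermitian_matrix H" shows "cnj (H $ i $ j) = H $ j $ i"
proof -
  have "conj_transpose H $ j $ i = H $ j $ i"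
    using assms by (simp only: hermitian_matrix_def)
  then show ?thesis by (simp add: conj_transpose_def)
qed

lemma trace_hermitian:
  fixes M H :: "complex^'n^'n"
  assumes M: "hermitian_matrix M" and H: "hermitian_matrix H"
  shows "trace (M ** H) = complex_of_real (inner M H)"
proof -
  have tr: "trace (M ** H) = (\<Sum>i\<in>UNIV. \<Sum>j\<in>UNIV. M $ i $ j * cnj (H $ i $ j))"
    unfolding trace_def matrix_matrix_mult_def vec_lambda_beta by (simp only: hermitian_entry[OF H])
  have "cnj (trace (M ** H)) = (\<Sum>i\<in>UNIV. \<Sum>j\<in>UNIV. M $ j $ i * cnj (H $ j $ i))"
    unfolding tr by (simp add: hermitian_entry[OF M] hermitian_entry[OF H])
  also have "\<dots> = trace (M ** H)" unfolding tr by (rule sum.swap)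
  finally have "Im (trace (M ** H)) = 0" by (simp add: complex_eq_iff)
  moreover have "Re (trace (M ** H)) = inner M H"
    by (simp only: tr inner_matrix Re_sum)
  ultimately show ?thesis by (simp add: complex_eq_iff)
qed

lemma hermitian_unitary_conj:
  "hermitian_matrix (U ** real_diag h ** conj_transpose U)"
  by (simp add: hermitian_matrix_def conj_transpose_mult matrix_mul_assoc)

text \<open>
  In a diagonalization of \<open>H\<close>, the curve is a sum of fixed matrices with coefficients
  \<open>exp (t h\<^sub>l)\<close>.
\<close>

lemma matrix_exp_has_derivative:
  assumes "hermitian_matrix H"
  shows "((\<lambda>t. matrix_exp (t *\<^sub>R H)) has_derivative (\<lambda>t. t *\<^sub>R H)) (at 0)"
    and "matrix_exp (0 *\<^sub>R H) = mat 1"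
proof -
  obtain U h where U: "unitary_matrix U" and H: "H = U ** real_diag h ** conj_transpose U"
    using assms by (rule hermitian_diagonalization)
  define E where "E l = U ** diag_matrix (axis l 1) ** conj_transpose U" for l
  have diag: "U ** diag_matrix (\<chi> l. complex_of_real (f l)) ** conj_transpose U = (\<Sum>l\<in>UNIV. f l *\<^sub>R E l)" for f
  proof -
    have "E l $ i $ j = U $ i $ l * conj_transpose U $ l $ j" for l i j
    proof -
      have "E l $ i $ j = (\<Sum>k\<in>UNIV. if k = l then U $ i $ l * conj_transpose U $ l $ j else 0)"
        unfolding E_def mult_diag_mult_entry by (intro sum.cong) (auto simp: axis_def)
      then show ?thesis by simp
    qed
    then show ?thesis
      by (simp add: vec_eq_iff mult_diag_mult_entry scaleR_conv_of_real[where 'a=complex] mult_ac)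
  qed
  have exp: "matrix_exp (t *\<^sub>R H) = (\<Sum>l\<in>UNIV. exp (t * h $ l) *\<^sub>R E l)" for t
    unfolding H matrix_exp_conj_real_diag[OF U] exp_diag_def by (simp only: diag vector_scaleR_component real_scaleR_def)
  have "((\<lambda>t. \<Sum>l\<in>UNIV. exp (t * h $ l) *\<^sub>R E l) has_derivative
      (\<lambda>t. \<Sum>l\<in>UNIV. (t * h $ l) *\<^sub>R E l)) (at 0)"
    by (auto intro!: derivative_eq_intros)
  moreover have "(\<Sum>l\<in>UNIV. (t * h $ l) *\<^sub>R E l) = t *\<^sub>R H" for t
    by (simp add: H real_diag_def diag scaleR_sum_right)
  ultimately show "((\<lambda>t. matrix_exp (t *\<^sub>R H)) has_derivative (\<lambda>t. t *\<^sub>R H)) (at 0)"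
    by (simp add: exp)
  show "matrix_exp (0 *\<^sub>R H) = mat 1"
    unfolding H matrix_exp_conj_real_diag[OF U] using U by (simp add: unitary_matrix_def)
qed

context unitary_representation
begin

lemma ln_nrm: "ln (nrm x) = ln ((nrm x)\<^sup>2) / 2"
  using nrm_pos[of x] by (cases "x = 0") (simp_all add: ln_realpow)

lemma log_norm_differentiable:
  assumes "w \<noteq> 0"
  shows "(\<lambda>g. ln (nrm (\<pi> g w))) differentiable (at (mat 1))"
proof -
  have "(\<lambda>g. (nrm (\<pi> g w - 0))\<^sup>2) differentiable (at (mat 1))"
    by (rule nrm_square_differentiable) (simp add: invertible_def)
  then obtain D where D: "((\<lambda>g. (nrm (\<pi> g w))\<^sup>2) has_derivative D) (at (mat 1))"
    by (auto simp: differentiable_def)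
  have pos: "0 < (nrm (\<pi> (mat 1) w))\<^sup>2" using nrm_pos[OF assms] by (simp add: rep_one)
  have "((\<lambda>x. ln x / 2) has_real_derivative inverse ((nrm (\<pi> (mat 1) w))\<^sup>2) / 2)
      (at ((nrm (\<pi> (mat 1) w))\<^sup>2))"
    using pos by (auto intro!: derivative_eq_intros simp: field_simps)
  from DERIV_compose_FDERIV[OF this D]
  show ?thesis unfolding differentiable_def ln_nrm by blast
qed

text \<open>
  The derivative of \<open>ln \<parallel>\<pi>(g) w\<parallel>\<close> at the identity is a real linear functional, so it is the inner
  product with some matrix, and the Hermitian part of that matrix represents it on Hermitian
  directions. Two Hermitian representatives \<open>M\<close>, \<open>M'\<close> agree because \<open>M' - M\<close> is itself a Hermitian
  direction.
\<close>

lemma moment_map_characterization: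
  assumes w: "w \<noteq> 0"
  shows "hermitian_matrix (moment_map ip \<pi> w)"
    and "\<And>H. hermitian_matrix H \<Longrightarrow>
      ((\<lambda>t. ln (nrm (\<pi> (matrix_exp (t *\<^sub>R H)) w))) has_real_derivative
        inner (moment_map ip \<pi> w) H) (at 0)"
proof -
  let ?f = "\<lambda>H t. ln (nrm (\<pi> (matrix_exp (t *\<^sub>R H)) w))"
  let ?P = "\<lambda>M. hermitian_matrix M \<and> (\<forall>H. hermitian_matrix H \<longrightarrow>
    (\<exists>d. (?f H has_real_derivative d) (at 0) \<and> trace (M ** H) = complex_of_real d))"
  obtain D where D: "((\<lambda>g. ln (nrm (\<pi> g w))) has_derivative D) (at (mat 1))"
    using log_norm_differentiable[OF w] by (auto simp: differentiable_def)
  have lin: "linear D" using D has_derivative_linear by blast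
  obtain A where A: "\<And>H. D H = inner A H" using real_linear_functional_inner[OF lin] by metis
  define M where "M = (1/2) *\<^sub>R (A + conj_transpose A)"
  have hM: "hermitian_matrix M"
    by (simp add: hermitian_matrix_def M_def conj_transpose_def vec_eq_iff)
  have der: "(?f H has_real_derivative inner M H) (at 0)" if H: "hermitian_matrix H" for H
  proof -
    have "((\<lambda>g. ln (nrm (\<pi> g w))) has_derivative D) (at (matrix_exp (0 *\<^sub>R H)))"
      using D by (simp only: matrix_exp_has_derivative(2)[OF H])
    from diff_chain_at[OF matrix_exp_has_derivative(1)[OF H] this]
    have "(?f H has_derivative (\<lambda>t. D (t *\<^sub>R H))) (at 0)" by (simp add: o_def)
    moreover have "D (t *\<^sub>R H) = inner M H * t" for t
      using H by (simp add: A M_def inner_add_left inner_conj_transpose hermitian_matrix_def)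
    ultimately show ?thesis by (simp add: has_field_derivative_def)
  qed
  have "?P M" using hM der trace_hermitian[OF hM] by blast
  moreover have "M' = M" if M': "?P M'" for M'
  proof -
    define H where "H = M' - M"
    have hM': "hermitian_matrix M'" using M' by blast
    have H: "hermitian_matrix H" using hM hM'
      by (simp add: H_def hermitian_matrix_def conj_transpose_def vec_eq_iff)
    obtain d where d: "(?f H has_real_derivative d) (at 0)" "trace (M' ** H) = complex_of_real d"
      using M' H by blast
    have "inner M' H = d" using d(2) trace_hermitian[OF hM' H] by simp
    also have "d = inner M H" using d(1) der[OF H] by (rule DERIV_unique)
    finally have "inner H H = 0" by (simp add: H_def inner_diff_left)
    then show ?thesis by (simp add: H_def)
  qed
  ultimately have "moment_map ip \<pi> w = M"
    unfolding moment_map_def by (intro the_equality)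
  then show "hermitian_matrix (moment_map ip \<pi> w)"
    "\<And>H. hermitian_matrix H \<Longrightarrow> (?f H has_real_derivative inner (moment_map ip \<pi> w) H) (at 0)"
    using hM der by simp_all
qed

text \<open>
  The moment map of the diagonal torus, multiplied by the squared norm.
\<close>

definition torus_moment :: "'v \<Rightarrow> real^'n" where
  "torus_moment w = (\<Sum>\<omega>\<in>\<Omega>. (nrm (component \<omega> w))\<^sup>2 *\<^sub>R real_weight \<omega>)"

text \<open>
  In the directions of the conjugate torus \<open>U T U\<^sup>*\<close>, the moment map at \<open>w\<close> is that of the diagonal
  torus \<open>T\<close> at \<open>\<pi>(U\<^sup>*) w\<close>. Both are the derivative of the logarithm of the same exponential sum.
\<close>

lemma moment_map_unitary_conj:
  assumes w: "w \<noteq> 0" and U: "unitary_matrix U"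
  shows "inner (moment_map ip \<pi> w) (U ** real_diag h ** conj_transpose U) * (nrm w)\<^sup>2
    = inner h (torus_moment (\<pi> (conj_transpose U) w))"
proof -
  let ?H = "U ** real_diag h ** conj_transpose U"
  note inv = unitary_invertible[OF U] unitary_invertible[OF unitary_conj_transpose[OF U]]
    invertible_exp_diag invertible_mult
  define w' where "w' = \<pi> (conj_transpose U) w"
  define q where "q \<omega> = (nrm (component \<omega> w'))\<^sup>2" for \<omega>
  have sum_q: "(\<Sum>\<omega>\<in>\<Omega>. q \<omega>) = (nrm w)\<^sup>2"
    unfolding q_def nrm_components[symmetric] w'_def
    by (simp add: nrm_unitary unitary_conj_transpose U)
  have pos: "0 < (nrm w)\<^sup>2" using nrm_pos[OF w] by simp
  have "nrm (\<pi> (matrix_exp (t *\<^sub>R ?H)) w) = nrm (\<pi> (exp_diag (t *\<^sub>R h)) w')" for t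
    by (simp add: matrix_exp_conj_real_diag[OF U] rep_mult inv nrm_unitary U w'_def)
  then have ln_eq: "ln (nrm (\<pi> (matrix_exp (t *\<^sub>R ?H)) w))
      = ln (\<Sum>\<omega>\<in>\<Omega>. q \<omega> * exp (2 * t * inner h (real_weight \<omega>))) / 2" for t
    unfolding ln_nrm by (simp add: nrm_exp_diag q_def mult.assoc)
  have "((\<lambda>t. ln (\<Sum>\<omega>\<in>\<Omega>. q \<omega> * exp (2 * t * inner h (real_weight \<omega>))) / 2)
      has_real_derivative inner (moment_map ip \<pi> w) ?H) (at 0)"
    using moment_map_characterization(2)[OF w hermitian_unitary_conj, of U h] unfolding ln_eq .
  moreover have "((\<lambda>t. ln (\<Sum>\<omega>\<in>\<Omega>. q \<omega> * exp (2 * t * inner h (real_weight \<omega>))) / 2)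
      has_real_derivative ((\<Sum>\<omega>\<in>\<Omega>. q \<omega> * (2 * inner h (real_weight \<omega>))) / (nrm w)\<^sup>2) / 2) (at 0)"
    using pos by (auto intro!: derivative_eq_intros sum.cong simp: sum_q mult_ac)
  ultimately have "inner (moment_map ip \<pi> w) ?H
      = ((\<Sum>\<omega>\<in>\<Omega>. q \<omega> * (2 * inner h (real_weight \<omega>))) / (nrm w)\<^sup>2) / 2"
    by (rule DERIV_unique)
  also have "(\<Sum>\<omega>\<in>\<Omega>. q \<omega> * (2 * inner h (real_weight \<omega>))) = 2 * inner h (torus_moment w')"
    by (simp add: torus_moment_def inner_sum_right sum_distrib_left q_def mult_ac)
  finally show ?thesis using pos by (simp add: w'_def field_simps)
qed

section \<open>Capacity and the moment map\<close>

lemma weight_margin_le: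
  assumes \<Gamma>: "\<Gamma> \<subseteq> \<Omega>" "0 \<notin> convex hull (real_weight ` \<Gamma>)" and y: "y \<in> convex hull (real_weight ` \<Gamma>)"
  shows "weight_margin scaleC \<pi> \<le> norm y"
proof -
  have "\<Gamma> \<noteq> {}" using y by auto
  then have "weight_margin scaleC \<pi> \<le> infdist 0 (convex hull (real_weight ` \<Gamma>))"
    unfolding weight_margin_def using \<Gamma>
    by (intro Min_le finite_subset[OF _ finite_imageI[OF finite_Pow_iff[THEN iffD2, OF finite_weights],
          of "\<lambda>\<Gamma>. infdist 0 (convex hull (real_weight ` \<Gamma>))"]]) auto
  also have "\<dots> \<le> norm y" using infdist_le[OF y, of 0] by simp
  finally show ?thesis .
qed

text \<open>
  The minimum runs over finitely many distances from \<open>0\<close> to compact sets that do not contain it. The nonzero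
  weight \<open>\<omega>\<close> makes the family nonempty.
\<close>

lemma weight_margin_pos:
  assumes "\<omega> \<in> \<Omega>" "\<omega> \<noteq> 0"
  shows "0 < weight_margin scaleC \<pi>"
proof -
  let ?S = "{infdist 0 (convex hull (real_weight ` \<Gamma>)) | \<Gamma>.
     \<Gamma> \<noteq> {} \<and> \<Gamma> \<subseteq> \<Omega> \<and> 0 \<notin> convex hull (real_weight ` \<Gamma>)}"
  have "finite ?S"
    by (rule finite_subset[OF _ finite_imageI[OF finite_Pow_iff[THEN iffD2, OF finite_weights],
          of "\<lambda>\<Gamma>. infdist 0 (convex hull (real_weight ` \<Gamma>))"]]) auto
  moreover have "real_weight \<omega> \<noteq> 0" using assms(2) by (auto simp: real_weight_def vec_eq_iff)
  then have "infdist 0 (convex hull (real_weight ` {\<omega>})) \<in> ?S" using assms(1) by fastforce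
  then have "?S \<noteq> {}" by blast
  ultimately have "weight_margin scaleC \<pi> \<in> ?S" unfolding weight_margin_def by (rule Min_in)
  then obtain \<Gamma> where \<Gamma>: "weight_margin scaleC \<pi> = infdist 0 (convex hull (real_weight ` \<Gamma>))"
    "\<Gamma> \<noteq> {}" "\<Gamma> \<subseteq> \<Omega>" "0 \<notin> convex hull (real_weight ` \<Gamma>)" by blast
  have "finite (real_weight ` \<Gamma>)" using \<Gamma>(3) finite_weights finite_subset by blast
  then have "closed (convex hull (real_weight ` \<Gamma>))"
    by (intro compact_imp_closed finite_imp_compact_convex_hull)
  then show ?thesis using \<Gamma> by (simp add: infdist_pos_not_in_closed)
qed

text \<open>
  Pair the moment map with the torus moment itself and apply the Cauchy-Schwarz inequality: conjugating
  and taking the diagonal part does not increase the norm.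
\<close>

lemma norm_torus_moment_le:
  assumes w: "w \<noteq> 0" and L: "unitary_matrix L"
  shows "norm (torus_moment (\<pi> L w)) \<le> norm (moment_map ip \<pi> w) * (nrm w)\<^sup>2"
proof -
  define h where "h = torus_moment (\<pi> L w)"
  let ?H = "conj_transpose L ** real_diag h ** conj_transpose (conj_transpose L)"
  have "(norm h)\<^sup>2 = inner (moment_map ip \<pi> w) ?H * (nrm w)\<^sup>2"
    unfolding moment_map_unitary_conj[OF w unitary_conj_transpose[OF L]]
    by (simp add: h_def power2_norm_eq_inner)
  also have "\<dots> \<le> (norm (moment_map ip \<pi> w) * norm ?H) * (nrm w)\<^sup>2"
    by (intro mult_right_mono norm_cauchy_schwarz) simp
  also have "norm ?H = norm h" by (rule norm_unitary_conj_real_diag[OF unitary_conj_transpose[OF L]])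
  finally have "norm h * norm h \<le> norm h * (norm (moment_map ip \<pi> w) * (nrm w)\<^sup>2)"
    by (simp add: power2_eq_square mult_ac)
  then have "norm h \<le> norm (moment_map ip \<pi> w) * (nrm w)\<^sup>2"
    by (cases "h = 0") auto
  then show ?thesis by (simp add: h_def)
qed

text \<open>
  With \<open>g = K exp(h) L\<close>, the outer factor \<open>K\<close> does not change the norm, and the rest is the exponential sum of
  \<open>\<pi>(L) w\<close> at \<open>2h\<close>. The bound depends on \<open>L\<close> only through the torus moment of \<open>\<pi>(L) w\<close>, which
  \<open>norm_torus_moment_le\<close> bounds uniformly in \<open>L\<close>.
\<close>

lemma orbit_norm_lower_bound:
  assumes w: "w \<noteq> 0" and margin: "0 < weight_margin scaleC \<pi>" and g: "invertible g"
  shows "(nrm w)\<^sup>2 * (1 - norm (moment_map ip \<pi> w) / weight_margin scaleC \<pi>) \<le> (nrm (\<pi> g w))\<^sup>2"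
proof -
  let ?\<gamma> = "weight_margin scaleC \<pi>"
  obtain K h L where K: "unitary_matrix K" and L: "unitary_matrix L"
    and g: "g = K ** exp_diag h ** L" using g by (rule KAK_decomposition)
  note inv = unitary_invertible[OF K] unitary_invertible[OF L] invertible_exp_diag invertible_mult
  define w' where "w' = \<pi> L w"
  define q where "q \<omega> = (nrm (component \<omega> w'))\<^sup>2" for \<omega>
  have sum_q: "sum q \<Omega> = (nrm w)\<^sup>2"
    unfolding q_def nrm_components[symmetric] w'_def by (simp add: nrm_unitary L)
  have "norm (torus_moment w') / ?\<gamma> \<le> norm (moment_map ip \<pi> w) * (nrm w)\<^sup>2 / ?\<gamma>"
    unfolding w'_def using margin by (intro divide_right_mono norm_torus_moment_le w L) simp
  then have "(nrm w)\<^sup>2 * (1 - norm (moment_map ip \<pi> w) / ?\<gamma>)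
      \<le> sum q \<Omega> - norm (torus_moment w') / ?\<gamma>"
    by (simp add: sum_q right_diff_distrib mult.commute)
  also have "\<dots> \<le> (\<Sum>\<omega>\<in>\<Omega>. q \<omega> * exp (inner (2 *\<^sub>R h) (real_weight \<omega>)))"
    unfolding torus_moment_def q_def[symmetric]
    by (rule exp_sum_lower_bound_image)
       (use margin finite_weights inj_real_weight weight_margin_le in \<open>auto simp: q_def intro: inj_on_subset\<close>)
  also have "\<dots> = (nrm (\<pi> g w))\<^sup>2"
    by (simp add: g rep_mult inv nrm_unitary K nrm_exp_diag q_def w'_def)
  finally show ?thesis .
qed

lemma moment_map_diagonalized:
  assumes w: "w \<noteq> 0"
  obtains U m where "unitary_matrix U" "norm m = norm (moment_map ip \<pi> w)"
    "inner m (torus_moment (\<pi> (conj_transpose U) w)) = (norm (moment_map ip \<pi> w))\<^sup>2 * (nrm w)\<^sup>2"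
proof -
  obtain U m where U: "unitary_matrix U" and m: "moment_map ip \<pi> w = U ** real_diag m ** conj_transpose U"
    using moment_map_characterization(1)[OF w] by (rule hermitian_diagonalization)
  show ?thesis
  proof (rule that[OF U])
    show "norm m = norm (moment_map ip \<pi> w)" unfolding m norm_unitary_conj_real_diag[OF U] ..
    show "inner m (torus_moment (\<pi> (conj_transpose U) w)) = (norm (moment_map ip \<pi> w))\<^sup>2 * (nrm w)\<^sup>2"
      using moment_map_unitary_conj[OF w U, of m]
      unfolding m[symmetric] power2_norm_eq_inner[symmetric] by simp
  qed
qed

text \<open>
  A step of length \<open>1 / (4 N\<^sup>2)\<close> against the gradient: \<open>g = exp(-\<mu>(w) / (4 N\<^sup>2))\<close> up to a unitary
  factor. In a diagonalization of \<open>\<mu>(w)\<close> the new squared norm is an exponential sum whose exponents are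
  at most \<open>1\<close> in absolute value, so \<open>exp_quadratic_bound\<close> applies to each term. Its linear
  terms sum to a multiple of \<open>\<parallel>\<mu>(w)\<parallel>\<^sup>2\<close>.
\<close>

lemma gradient_step_decreases_norm:
  assumes w: "w \<noteq> 0" and N: "0 < N" "\<And>\<omega>. \<omega> \<in> \<Omega> \<Longrightarrow> norm (real_weight \<omega>) \<le> N"
  obtains g where "invertible g"
    "(nrm (\<pi> g w))\<^sup>2 \<le> (nrm w)\<^sup>2 * (1 - (norm (moment_map ip \<pi> w))\<^sup>2 / (4 * N\<^sup>2))"
proof -
  let ?\<mu> = "norm (moment_map ip \<pi> w)"
  obtain U m where U: "unitary_matrix U" and m: "norm m = ?\<mu>"
    and tm: "inner m (torus_moment (\<pi> (conj_transpose U) w)) = ?\<mu>\<^sup>2 * (nrm w)\<^sup>2"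
    using w by (rule moment_map_diagonalized)
  note inv = unitary_invertible[OF unitary_conj_transpose[OF U]] invertible_exp_diag invertible_mult
  define w' where "w' = \<pi> (conj_transpose U) w"
  define q where "q \<omega> = (nrm (component \<omega> w'))\<^sup>2" for \<omega>
  define a where "a \<omega> = inner m (real_weight \<omega>)" for \<omega> :: "(int, 'n) vec"
  have q0: "0 \<le> q \<omega>" for \<omega> by (simp add: q_def)
  have sum_q: "sum q \<Omega> = (nrm w)\<^sup>2"
    unfolding q_def nrm_components[symmetric] w'_def
    by (simp add: nrm_unitary unitary_conj_transpose U)
  have sum_qa: "(\<Sum>\<omega>\<in>\<Omega>. q \<omega> * a \<omega>) = ?\<mu>\<^sup>2 * (nrm w)\<^sup>2"
    using tm unfolding w'_def[symmetric] by (simp add: torus_moment_def inner_sum_right q_def a_def)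
  have a: "\<bar>a \<omega>\<bar> \<le> ?\<mu> * N" if "\<omega> \<in> \<Omega>" for \<omega>
  proof -
    have "\<bar>a \<omega>\<bar> \<le> norm m * norm (real_weight \<omega>)"
      unfolding a_def by (rule Cauchy_Schwarz_ineq2)
    also have "\<dots> \<le> ?\<mu> * N" unfolding m using N that by (intro mult_left_mono) auto
    finally show ?thesis .
  qed
  have pos: "0 < (nrm w)\<^sup>2" using nrm_pos[OF w] by simp
  \<comment> \<open>This keeps the exponents of the step within the range of \<open>exp_quadratic_bound\<close>.\<close>
  have "?\<mu> \<le> N"
  proof -
    have "?\<mu>\<^sup>2 * (nrm w)\<^sup>2 \<le> (\<Sum>\<omega>\<in>\<Omega>. q \<omega> * (?\<mu> * N))"
      unfolding sum_qa[symmetric] using a by (intro sum_mono mult_left_mono q0) force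
    also have "\<dots> = (?\<mu> * N) * (nrm w)\<^sup>2" by (simp add: sum_distrib_right[symmetric] sum_q mult.commute)
    finally have "(?\<mu> * ?\<mu>) * (nrm w)\<^sup>2 \<le> (?\<mu> * N) * (nrm w)\<^sup>2"
      by (simp add: power2_eq_square[of ?\<mu>])
    then have "?\<mu> * ?\<mu> \<le> ?\<mu> * N" by (rule mult_right_le_imp_le[OF _ pos])
    then show ?thesis using N(1) by (cases "?\<mu> = 0") auto
  qed
  define s where "s = 1 / (4 * N\<^sup>2)"
  have s: "0 < s" using N by (simp add: s_def)
  have small: "\<bar>- (2 * s * a \<omega>)\<bar> \<le> 1" if "\<omega> \<in> \<Omega>" for \<omega>
  proof -
    have "\<bar>- (2 * s * a \<omega>)\<bar> = 2 * s * \<bar>a \<omega>\<bar>" using s by (simp add: abs_mult)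
    also have "\<dots> \<le> 2 * s * (N * N)"
      using s order_trans[OF a[OF that] mult_right_mono[OF \<open>?\<mu> \<le> N\<close>, of N]] N(1)
      by (intro mult_left_mono) auto
    also have "\<dots> \<le> 1" using N(1) by (simp add: s_def power2_eq_square)
    finally show ?thesis .
  qed
  have bound: "exp (- (2 * s * a \<omega>)) \<le> 1 - 2 * s * a \<omega> + 4 * s\<^sup>2 * (?\<mu> * N)\<^sup>2" if "\<omega> \<in> \<Omega>" for \<omega>
  proof -
    have "(a \<omega>)\<^sup>2 \<le> (?\<mu> * N)\<^sup>2" using a[OF that] by (metis abs_ge_zero power2_abs power_mono)
    then have "4 * s\<^sup>2 * (a \<omega>)\<^sup>2 \<le> 4 * s\<^sup>2 * (?\<mu> * N)\<^sup>2" by (intro mult_left_mono) auto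
    then show ?thesis
      using exp_quadratic_bound[OF small[OF that]] by (simp add: power_mult_distrib)
  qed
  have "(nrm (\<pi> (exp_diag (- (s *\<^sub>R m)) ** conj_transpose U) w))\<^sup>2
      = (\<Sum>\<omega>\<in>\<Omega>. q \<omega> * exp (- (2 * s * a \<omega>)))"
    by (simp add: rep_mult inv nrm_exp_diag q_def w'_def a_def mult.assoc)
  also have "\<dots> \<le> (\<Sum>\<omega>\<in>\<Omega>. q \<omega> * (1 - 2 * s * a \<omega> + 4 * s\<^sup>2 * (?\<mu> * N)\<^sup>2))"
    by (intro sum_mono mult_left_mono bound q0)
  also have "\<dots> = sum q \<Omega> - 2 * s * (\<Sum>\<omega>\<in>\<Omega>. q \<omega> * a \<omega>) + sum q \<Omega> * (4 * s\<^sup>2 * (?\<mu> * N)\<^sup>2)"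
    by (simp add: sum_distrib_left sum_distrib_right distrib_left right_diff_distrib sum.distrib sum_subtractf mult_ac)
  also have "\<dots> = (nrm w)\<^sup>2 * (1 - 2 * s * ?\<mu>\<^sup>2 + 4 * s\<^sup>2 * (?\<mu> * N)\<^sup>2)"
    unfolding sum_q sum_qa by (simp add: algebra_simps)
  also have "1 - 2 * s * ?\<mu>\<^sup>2 + 4 * s\<^sup>2 * (?\<mu> * N)\<^sup>2 = 1 - ?\<mu>\<^sup>2 / (4 * N\<^sup>2)"
    using N(1) by (simp add: s_def power2_eq_square field_simps)
  finally show ?thesis by (intro that[of "exp_diag (- (s *\<^sub>R m)) ** conj_transpose U"] inv) simp
qed

abbreviation "cap \<equiv> capacity ip \<pi>"

lemma invertible_one: "invertible (mat 1 :: complex^'n^'n)"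
  by (simp add: invertible_def)

lemma capacity_le: "invertible g \<Longrightarrow> cap v \<le> nrm (\<pi> g v)"
  unfolding capacity_def by (rule cINF_lower) (auto intro!: bdd_belowI2[of _ 0] nrm_nonneg)

lemma capacity_greatest: "(\<And>g. invertible g \<Longrightarrow> c \<le> nrm (\<pi> g v)) \<Longrightarrow> c \<le> cap v"
  unfolding capacity_def by (rule cINF_greatest) (use invertible_one in auto)

text \<open>
  The lower bound at the orbit point \<open>\<pi>(g) v\<close> holds on its whole orbit, which is the orbit of \<open>v\<close>.
\<close>

lemma capacity_pos_if_moment_small:
  assumes v: "v \<noteq> 0" and margin: "0 < weight_margin scaleC \<pi>" and g: "invertible g"
    and small: "norm (moment_map ip \<pi> (\<pi> g v)) < weight_margin scaleC \<pi>"
  shows "0 < cap v"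
proof -
  define w where "w = \<pi> g v"
  have w: "w \<noteq> 0" unfolding w_def using g v by (rule rep_nonzero)
  define c where "c = (nrm w)\<^sup>2 * (1 - norm (moment_map ip \<pi> w) / weight_margin scaleC \<pi>)"
  have c: "0 < c" unfolding c_def using nrm_pos[OF w] small margin by (simp add: w_def)
  obtain g' where g': "g ** g' = mat 1" "g' ** g = mat 1" using g by (auto simp: invertible_def)
  then have inv': "invertible g'" by (auto simp: invertible_def)
  have "sqrt c \<le> nrm (\<pi> h v)" if h: "invertible h" for h
  proof -
    have "\<pi> (h ** g') w = \<pi> h v"
      using h inv' g g' by (simp add: w_def rep_mult rep_inverse_cancel)
    then have "c \<le> (nrm (\<pi> h v))\<^sup>2"
      using orbit_norm_lower_bound[OF w margin invertible_mult[OF h inv']] by (simp add: c_def)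
    then show ?thesis using nrm_nonneg by (intro real_le_lsqrt)
  qed
  then have "sqrt c \<le> cap v" by (rule capacity_greatest)
  moreover have "0 < sqrt c" using c by simp
  ultimately show ?thesis by linarith
qed

text \<open>
  The norm reached by the gradient step is at least the capacity. Take logarithms and use
  \<open>1 - \<delta> \<le> exp(-\<delta>)\<close>.
\<close>

lemma moment_map_le_log_gap:
  assumes v: "v \<noteq> 0" and N: "0 < N" "\<And>\<omega>. \<omega> \<in> \<Omega> \<Longrightarrow> norm (real_weight \<omega>) \<le> N"
    and cap: "0 < cap v" and g: "invertible g"
  shows "(norm (moment_map ip \<pi> (\<pi> g v)))\<^sup>2 \<le> 8 * N\<^sup>2 * (ln (nrm (\<pi> g v)) - ln (cap v))"
proof -
  define w where "w = \<pi> g v"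
  have w: "w \<noteq> 0" unfolding w_def using g v by (rule rep_nonzero)
  define \<delta> where "\<delta> = (norm (moment_map ip \<pi> w))\<^sup>2 / (4 * N\<^sup>2)"
  obtain h where h: "invertible h" "(nrm (\<pi> h w))\<^sup>2 \<le> (nrm w)\<^sup>2 * (1 - \<delta>)"
    unfolding \<delta>_def using w N by (rule gradient_step_decreases_norm)
  have "cap v \<le> nrm (\<pi> h w)"
    using capacity_le[OF invertible_mult[OF h(1) g]] h(1) g by (simp add: rep_mult w_def)
  then have "(cap v)\<^sup>2 \<le> (nrm (\<pi> h w))\<^sup>2" using cap by (intro power_mono) auto
  also note h(2)
  also have "(nrm w)\<^sup>2 * (1 - \<delta>) \<le> (nrm w)\<^sup>2 * exp (- \<delta>)"
    using exp_ge_add_one_self[of "- \<delta>"] by (intro mult_left_mono) auto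
  finally have le: "(cap v)\<^sup>2 \<le> (nrm w)\<^sup>2 * exp (- \<delta>)" .
  have "2 * ln (cap v) = ln ((cap v)\<^sup>2)" using cap by (simp add: ln_realpow)
  also have "\<dots> \<le> ln ((nrm w)\<^sup>2 * exp (- \<delta>))" using le cap nrm_pos[OF w] by (subst ln_le_cancel_iff) auto
  also have "\<dots> = 2 * ln (nrm w) - \<delta>" using nrm_pos[OF w] by (simp add: ln_mult ln_realpow)
  finally have "\<delta> \<le> 2 * (ln (nrm w) - ln (cap v))" by simp
  then show ?thesis using N(1) by (simp add: \<delta>_def w_def field_simps)
qed

end

context ordered_unitary_representation
begin

text \<open>
  Along a minimizing sequence for the capacity, \<open>moment_map_le_log_gap\<close> makes the moment map tend to
  zero.
\<close>

lemma moment_polytope_contains_zero: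
  assumes v: "v \<noteq> 0" and N: "0 < N" "\<And>\<omega>. \<omega> \<in> \<Omega> \<Longrightarrow> norm (real_weight \<omega>) \<le> N"
    and cap: "0 < cap v"
  shows "0 \<in> moment_polytope ip \<pi> v"
  unfolding moment_polytope_def closure_approachable
proof (intro allI impI)
  fix e :: real assume e: "0 < e"
  define \<epsilon> where "\<epsilon> = e\<^sup>2 / (8 * N\<^sup>2)"
  have \<epsilon>: "0 < \<epsilon>" using e N by (simp add: \<epsilon>_def)
  have "\<exists>g. invertible g \<and> nrm (\<pi> g v) < cap v * exp \<epsilon>"
  proof (rule ccontr)
    assume "\<not> ?thesis"
    then have "cap v * exp \<epsilon> \<le> cap v" by (intro capacity_greatest) (simp add: not_less)
    then show False using cap \<epsilon> by (simp add: mult_le_cancel_left1)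
  qed
  then obtain g where g: "invertible g" "nrm (\<pi> g v) < cap v * exp \<epsilon>" by blast
  define w where "w = \<pi> g v"
  have w: "w \<noteq> 0" unfolding w_def using g(1) v by (rule rep_nonzero)
  have "ln (nrm w) < ln (cap v * exp \<epsilon>)"
    using g(2) nrm_pos[OF w] cap by (subst ln_less_cancel_iff) (auto simp: w_def)
  also have "\<dots> = ln (cap v) + \<epsilon>" using cap by (simp add: ln_mult)
  finally have "8 * N\<^sup>2 * (ln (nrm w) - ln (cap v)) < 8 * N\<^sup>2 * \<epsilon>"
    using N(1) by (intro mult_strict_left_mono) auto
  also have "\<dots> = e\<^sup>2" using N(1) by (simp add: \<epsilon>_def)
  finally have "(norm (moment_map ip \<pi> w))\<^sup>2 < e\<^sup>2"
    using moment_map_le_log_gap[OF v N cap g(1)] unfolding w_def by linarith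
  then have "norm (moment_map ip \<pi> w) < e" 
    by (rule power_less_imp_less_base[OF _ less_imp_le[OF e]])
  then have "dist (spec (moment_map ip \<pi> w)) 0 < e"
    by (simp add: norm_spec_hermitian moment_map_characterization(1)[OF w])
  then show "\<exists>y\<in>{spec (moment_map ip \<pi> (\<pi> g v)) |g. invertible g}. dist y 0 < e"
    using g(1) unfolding w_def by blast
qed

end

theorem corollary1p19:
  fixes scaleC :: "complex \<Rightarrow> 'v::ab_group_add \<Rightarrow> 'v" and Basis :: "'v set"
    and ip :: "'v \<Rightarrow> 'v \<Rightarrow> complex"
    and \<pi> :: "complex^'n::{finite,linorder}^'n::{finite,linorder} \<Rightarrow> 'v \<Rightarrow> 'v"
    and v :: 'v
  assumes "rational_representation scaleC Basis \<pi>"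
    and "hermitian_inner_product scaleC ip"
    and "unitary_invariant ip \<pi>"
    and "\<exists>\<omega>\<in>weights scaleC \<pi>. \<omega> \<noteq> 0"
    and "v \<noteq> 0"
  shows "(0 \<in> moment_polytope ip \<pi> v \<longleftrightarrow>
            (\<exists>p\<in>moment_polytope ip \<pi> v. norm p < weight_margin scaleC \<pi>)) \<and>
         (\<forall>g. invertible g \<longrightarrow>
            (0 < capacity ip \<pi> v \<longrightarrow>
               scaling_solution ip \<pi> v (weight_margin scaleC \<pi> / 2) g) \<longrightarrow>
            (0 < capacity ip \<pi> v \<longleftrightarrow>
               norm (moment_map ip \<pi> (\<pi> g v)) \<le> weight_margin scaleC \<pi> / 2)) \<and>
         (\<forall>g. invertible g \<longrightarrow>
            (0 < capacity ip \<pi> v \<longrightarrow>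
               norm_minimization_solution ip \<pi> v
                 (1 / 8 * (weight_margin scaleC \<pi> / (2 * weight_norm scaleC \<pi>))\<^sup>2) g) \<longrightarrow>
            (0 < capacity ip \<pi> v \<longleftrightarrow>
               norm (moment_map ip \<pi> (\<pi> g v)) \<le> weight_margin scaleC \<pi> / 2))"
proof -
  interpret ordered_unitary_representation scaleC Basis \<pi> ip
    using assms(1-3)
    by (intro ordered_unitary_representation.intro unitary_representation.intro
        unitary_representation_axioms.intro)
  let ?\<gamma> = "weight_margin scaleC \<pi>" and ?N = "weight_norm scaleC \<pi>"
  obtain \<omega> where \<omega>: "\<omega> \<in> \<Omega>" "\<omega> \<noteq> 0" using assms(4) by blast
  have \<gamma>: "0 < ?\<gamma>" using \<omega> by (rule weight_margin_pos)
  have "0 < norm (real_weight \<omega>)" using \<omega>(2) by (auto simp: real_weight_def vec_eq_iff)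
  then have N: "0 < ?N" using norm_weight_le_weight_norm[OF \<omega>(1)] by linarith
  note N_bound = norm_weight_le_weight_norm
  have cap_pos: "0 < cap v" if "invertible g" "norm (moment_map ip \<pi> (\<pi> g v)) < ?\<gamma>" for g
    using capacity_pos_if_moment_small[OF \<open>v \<noteq> 0\<close> \<gamma> that] .
  have zero: "0 \<in> moment_polytope ip \<pi> v" if "p \<in> moment_polytope ip \<pi> v" "norm p < ?\<gamma>" for p
  proof -
    have "\<exists>y\<in>{spec (moment_map ip \<pi> (\<pi> g v)) |g. invertible g}. dist y p < ?\<gamma> - norm p"
      using that(1) unfolding moment_polytope_def closure_approachable
      by (rule allE[of _ "?\<gamma> - norm p"]) (use that(2) in simp)
    then obtain g where g: "invertible g"
      and near: "dist (spec (moment_map ip \<pi> (\<pi> g v))) p < ?\<gamma> - norm p" by blast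
    have "norm (spec (moment_map ip \<pi> (\<pi> g v))) < ?\<gamma>"
      using near norm_triangle_ineq2[of "spec (moment_map ip \<pi> (\<pi> g v))" p] by (simp add: dist_norm)
    then have "norm (moment_map ip \<pi> (\<pi> g v)) < ?\<gamma>"
      using norm_spec_hermitian moment_map_characterization(1)[OF rep_nonzero[OF g \<open>v \<noteq> 0\<close>]] by metis
    then show ?thesis
      using moment_polytope_contains_zero[OF \<open>v \<noteq> 0\<close> N N_bound cap_pos[OF g]] by blast
  qed
  have decide: "0 < cap v \<longleftrightarrow> norm (moment_map ip \<pi> (\<pi> g v)) \<le> ?\<gamma> / 2"
    if "invertible g" "0 < cap v \<Longrightarrow> norm (moment_map ip \<pi> (\<pi> g v)) \<le> ?\<gamma> / 2" for g
    using that cap_pos[OF that(1)] \<gamma> by fastforce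
  have small: "norm (moment_map ip \<pi> (\<pi> g v)) \<le> ?\<gamma> / 2"
    if "0 < cap v" "norm_minimization_solution ip \<pi> v (1 / 8 * (?\<gamma> / (2 * ?N))\<^sup>2) g" for g
  proof -
    have g: "invertible g" "ln (nrm (\<pi> g v)) - ln (cap v) \<le> 1 / 8 * (?\<gamma> / (2 * ?N))\<^sup>2"
      using that(2) by (auto simp: norm_minimization_solution_def)
    have "(norm (moment_map ip \<pi> (\<pi> g v)))\<^sup>2 \<le> 8 * ?N\<^sup>2 * (ln (nrm (\<pi> g v)) - ln (cap v))"
      using moment_map_le_log_gap[OF \<open>v \<noteq> 0\<close> N N_bound that(1) g(1)] .
    also have "\<dots> \<le> 8 * ?N\<^sup>2 * (1 / 8 * (?\<gamma> / (2 * ?N))\<^sup>2)"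
      using g(2) by (intro mult_left_mono) auto
    also have "\<dots> = (?\<gamma> / 2)\<^sup>2" using N by (simp add: power2_eq_square field_simps)
    finally show ?thesis by (rule power2_le_imp_le) (use \<gamma> in simp)
  qed
  show ?thesis
  proof (intro conjI allI impI)
    show "0 \<in> moment_polytope ip \<pi> v \<longleftrightarrow> (\<exists>p\<in>moment_polytope ip \<pi> v. norm p < ?\<gamma>)"
      using zero \<gamma> by (auto intro: bexI[of _ 0])
  next
    fix g assume "invertible g" "0 < cap v \<longrightarrow> scaling_solution ip \<pi> v (?\<gamma> / 2) g"
    then show "0 < cap v \<longleftrightarrow> norm (moment_map ip \<pi> (\<pi> g v)) \<le> ?\<gamma> / 2"
      using decide by (simp add: scaling_solution_def)
  next
    fix g assume "invertible g" "0 < cap v \<longrightarrow>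
      norm_minimization_solution ip \<pi> v (1 / 8 * (?\<gamma> / (2 * ?N))\<^sup>2) g"
    then show "0 < cap v \<longleftrightarrow> norm (moment_map ip \<pi> (\<pi> g v)) \<le> ?\<gamma> / 2"
      using decide small by blast
  qed
qed

end
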